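(* Let $(b,c)$ be one of the pairs $(2,2)$ or $(1,4)$. Then the canonical basis $\mathcal{B}$ of $\mathcal{A}(b,c)$ is the disjoint union of the set of all cluster monomials and the set $\{z_n : n\ge 1\}$.
   Context: Let $\mathcal{F}=\mathbb{Q}(y_1,y_2)$ be the field of rational functions in two commuting independent variables. For positive integers $b,c$ define $y_m\in\mathcal{F}$ for all $m\in\mathbb{Z}$ recursively by $y_{m-1}y_{m+1}=y_m^b+1$ for $m$ odd and $y_{m-1}y_{m+1}=y_m^c+1$ for $m$ even. The cluster algebra $\mathcal{A}(b,c)$ is the subring of $\mathcal{F}$ generated by all $y_m$, $m\in\mathbb{Z}$. It is known (Laurent phenomenon) that for each $m\in\mathbb{Z}$ every element of $\mathcal{A}(b,c)$ is uniquely a Laurent polynomial with integer coefficients in $y_m$ and $y_{m+1}$. A cluster monomial is an element of the form $y_m^p y_{m+1}^q$ with $m\in\mathbb{Z}$ and $p,q\in\mathbb{Z}_{\ge0}$. Define $z\in\mathcal{A}(b,c)$ by $z=y_0y_3-y_1y_2$ if $(b,c)=(2,2)$, and $z=y_0^2y_3-(y_1+2)y_2^2$ if $(b,c)=(1,4)$. Let $T_0=1$ and, for $n>0$, let $T_n$ be the polynomial with $T_n(t+t^{-1})=t^n+t^{-n}$ (Chebyshev polynomials of the first kind). Put $z_n=T_n(z)$ for $n\ge1$. A non-zero element $y\in\mathcal{A}(b,c)$ is called positive if for every $m\in\mathbb{Z}$ all the (non-zero) coefficients in the expansion of $y$ as a Laurent polynomial in $y_m$ and $y_{m+1}$ are positive.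 When $bc\le 4$, the canonical basis $\mathcal{B}$ is the unique $\mathbb{Z}$-basis of $\mathcal{A}(b,c)$ such that the set of positive elements consists precisely of the positive integer linear combinations of elements of $\mathcal{B}$ (existence and uniqueness is a theorem of the same paper). *)

theory Defs
  imports
    "HOL-Computational_Algebra.Polynomial"
    "HOL-Computational_Algebra.Fraction_Field"
    "HOL-Library.Poly_Mapping"
begin

text \<open>The field of rational functions in two variables is the fraction field of
  \<open>(\<rat>[y\<^sub>1])[y\<^sub>2]\<close>.\<close>

type_synonym ratfun2 = "rat poly poly fract"

definition var1 :: ratfun2 where
  "var1 = Fract [:[:0, 1:]:] 1"

definition var2 :: ratfun2 where
  "var2 = Fract [:0, 1:] 1"

text \<open>The exchange relations solved for the new variable: upwards from
  \<open>(y\<^sub>1, y\<^sub>2)\<close> for \<open>m > 2\<close>, downwards for \<open>m < 1\<close>. The divisors never vanish, so the relation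
  itself holds at every index (\<open>cluster_var_exchange\<close> below).\<close>

definition exchange_exp :: "nat \<Rightarrow> nat \<Rightarrow> int \<Rightarrow> nat" where
  "exchange_exp b c m = (if odd m then b else c)"

function cluster_var :: "nat \<Rightarrow> nat \<Rightarrow> int \<Rightarrow> ratfun2" where
  "cluster_var b c m =
     (if m = 1 then var1
      else if m = 2 then var2
      else if m > 2 then
        (cluster_var b c (m - 1) ^ exchange_exp b c (m - 1) + 1) / cluster_var b c (m - 2)
      else
        (cluster_var b c (m + 1) ^ exchange_exp b c (m + 1) + 1) / cluster_var b c (m + 2))"
  by pat_completeness auto
termination
  by (relation "measure (\<lambda>(b, c, m). nat \<bar>2 * m - 3\<bar>)") auto

declare cluster_var.simps [simp del]

lemma cluster_var_1: "cluster_var b c 1 = var1"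
  and cluster_var_2: "cluster_var b c 2 = var2"
  by (simp_all add: cluster_var.simps)

text \<open>Positivity with respect to the order that the library puts on the fraction field of an
  ordered domain; it is used only to see that no cluster variable is zero.\<close>

lemma cluster_var_pos: "cluster_var b c m > 0"
proof (induction b c m rule: cluster_var.induct)
  case (1 b c m)
  have "var1 > 0" "var2 > 0"
    unfolding var1_def var2_def Fraction_Field.zero_less_Fract_iff[OF zero_less_one]
    by (simp_all add: less_poly_def pos_poly_pCons one_pCons)
  then show ?case
    using 1 by (subst cluster_var.simps) (auto intro!: divide_pos_pos add_pos_pos)
qed

lemma cluster_var_exchange:
  "cluster_var b c (m - 1) * cluster_var b c (m + 1) =
     cluster_var b c m ^ (if odd m then b else c) + 1"
proof (cases "m \<ge> 2")
  case True
  then show ?thesis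
    using cluster_var_pos[of b c "m - 1"]
    by (subst (2) cluster_var.simps) (simp add: exchange_exp_def)
next
  case False
  then show ?thesis
    using cluster_var_pos[of b c "m + 1"]
    by (subst (1) cluster_var.simps) (simp add: exchange_exp_def add.commute)
qed

inductive_set cluster_algebra :: "nat \<Rightarrow> nat \<Rightarrow> ratfun2 set" for b c :: nat where
  one: "1 \<in> cluster_algebra b c"
| var: "cluster_var b c m \<in> cluster_algebra b c"
| diff: "x \<in> cluster_algebra b c \<Longrightarrow> y \<in> cluster_algebra b c \<Longrightarrow> x - y \<in> cluster_algebra b c"
| mult: "x \<in> cluster_algebra b c \<Longrightarrow> y \<in> cluster_algebra b c \<Longrightarrow> x * y \<in> cluster_algebra b c"

definition cluster_monomials :: "nat \<Rightarrow> nat \<Rightarrow> ratfun2 set" where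
  "cluster_monomials b c =
     {cluster_var b c m ^ p * cluster_var b c (m + 1) ^ q | (m :: int) (p :: nat) (q :: nat). True}"

text \<open>An integer Laurent polynomial in two variables is a finitely supported family of
  integer coefficients indexed by the exponent pairs.\<close>

definition laurent_eval :: "((int \<times> int) \<Rightarrow>\<^sub>0 int) \<Rightarrow> ratfun2 \<Rightarrow> ratfun2 \<Rightarrow> ratfun2" where
  "laurent_eval f u v =
     (\<Sum>k\<in>Poly_Mapping.keys f. of_int (Poly_Mapping.lookup f k) * u powi fst k * v powi snd k)"

text \<open>By the Laurent phenomenon the expansion \<open>f\<close> below exists and is unique for every
  \<open>x\<close> in the cluster algebra; \<open>keys\<close> are the exponents with nonzero coefficient.\<close>

definition positive_element :: "nat \<Rightarrow> nat \<Rightarrow> ratfun2 \<Rightarrow> bool" where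
  "positive_element b c x \<longleftrightarrow>
     x \<in> cluster_algebra b c \<and> x \<noteq> 0 \<and>
     (\<forall>m. \<exists>f. laurent_eval f (cluster_var b c m) (cluster_var b c (m + 1)) = x \<and>
        (\<forall>k\<in>Poly_Mapping.keys f. Poly_Mapping.lookup f k > 0))"

interpretation zmod: module "\<lambda>(k :: int) (x :: ratfun2). of_int k * x"
  by unfold_locales (simp_all add: algebra_simps)

definition positive_combinations :: "ratfun2 set \<Rightarrow> ratfun2 set" where
  "positive_combinations B =
     {\<Sum>x\<in>S. of_int (a x) * x | S (a :: ratfun2 \<Rightarrow> int).
        finite S \<and> S \<noteq> {} \<and> S \<subseteq> B \<and> (\<forall>x\<in>S. a x > 0)}"

definition is_canonical_basis :: "nat \<Rightarrow> nat \<Rightarrow> ratfun2 set \<Rightarrow> bool" where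
  "is_canonical_basis b c B \<longleftrightarrow>
     zmod.independent B \<and> zmod.span B = cluster_algebra b c \<and>
     {x. positive_element b c x} = positive_combinations B"

definition canonical_basis :: "nat \<Rightarrow> nat \<Rightarrow> ratfun2 set" where
  "canonical_basis b c = (THE B. is_canonical_basis b c B)"

text \<open>The convention \<open>T\<^sub>0 = 1\<close> does not follow the general rule, which would give \<open>2\<close>.
  The identity is imposed at all nonzero rational \<open>t\<close>, which amounts to the identity of Laurent
  polynomials in \<open>t\<close>.\<close>

definition chebyshev_T :: "nat \<Rightarrow> int poly" where
  "chebyshev_T n =
     (if n = 0 then 1
      else THE p. \<forall>t::rat. t \<noteq> 0 \<longrightarrow>
        poly (map_poly of_int p) (t + inverse t) = t ^ n + inverse t ^ n)"

lemma chebyshev_T_exists: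
  "\<exists>p :: int poly. \<forall>t::rat. t \<noteq> 0 \<longrightarrow>
     poly (map_poly of_int p) (t + inverse t) = t ^ n + inverse t ^ n"
proof (induction n rule: induct_nat_012)
  case 0
  show ?case by (rule exI[of _ "[:2:]"]) (simp add: map_poly_pCons)
next
  case 1
  show ?case by (rule exI[of _ "[:0, 1:]"]) (simp add: map_poly_pCons)
next
  case (ge2 n)
  then obtain p q :: "int poly" where
    p: "\<And>t::rat. t \<noteq> 0 \<Longrightarrow> poly (map_poly of_int p) (t + inverse t) = t ^ n + inverse t ^ n" and
    q: "\<And>t::rat. t \<noteq> 0 \<Longrightarrow>
          poly (map_poly of_int q) (t + inverse t) = t ^ Suc n + inverse t ^ Suc n"
    by blast
  have hom: "map_poly of_int ([:0, 1:] * q - p) =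
      [:0, 1:] * map_poly of_int q - (map_poly of_int p :: rat poly)"
    by (intro poly_eqI) (simp add: coeff_map_poly coeff_pCons split: nat.split)
  show ?case
  proof (intro exI[of _ "[:0, 1:] * q - p"] allI impI)
    fix t :: rat
    assume t: "t \<noteq> 0"
    have "poly (map_poly of_int ([:0, 1:] * q - p)) (t + inverse t) =
        (t + inverse t) * (t ^ Suc n + inverse t ^ Suc n) - (t ^ n + inverse t ^ n)"
      by (simp only: hom poly_diff poly_mult p[OF t] q[OF t]) simp
    also have "\<dots> = t ^ Suc (Suc n) + inverse t ^ Suc (Suc n)
        + (t * inverse t) * (t ^ n + inverse t ^ n) - (t ^ n + inverse t ^ n)"
      by (simp add: algebra_simps)
    also have "\<dots> = t ^ Suc (Suc n) + inverse t ^ Suc (Suc n)"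
      using t by simp
    finally show "poly (map_poly of_int ([:0, 1:] * q - p)) (t + inverse t) =
        t ^ Suc (Suc n) + inverse t ^ Suc (Suc n)" .
  qed
qed

lemma chebyshev_T_unique:
  fixes p q :: "int poly"
  assumes "\<And>t::rat. t \<noteq> 0 \<Longrightarrow>
    poly (map_poly of_int p) (t + inverse t) = poly (map_poly of_int q) (t + inverse t)"
  shows "p = q"
proof (rule ccontr)
  let ?r = "map_poly of_int p - map_poly of_int q :: rat poly"
  assume "p \<noteq> q"
  then have "?r \<noteq> 0"
    by (auto simp: poly_eq_iff coeff_map_poly)
  then have fin: "finite {x. poly ?r x = 0}"
    by (rule poly_roots_finite)
  have "inj_on (\<lambda>t::rat. t + inverse t) {1<..}"
  proof (rule inj_onI)
    fix s t :: rat
    assume st: "s \<in> {1<..}" "t \<in> {1<..}" "s + inverse s = t + inverse t"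
    then have "(s - t) * (s * t - 1) = 0"
      by (simp add: field_simps)
    moreover have "s * t > 1"
      using st less_1_mult by auto
    ultimately show "s = t"
      by simp
  qed
  moreover have "infinite {1::rat<..}"
    by (rule infinite_Ioi)
  ultimately have "infinite ((\<lambda>t::rat. t + inverse t) ` {1<..})"
    by (simp add: finite_image_iff)
  moreover have "(\<lambda>t::rat. t + inverse t) ` {1<..} \<subseteq> {x. poly ?r x = 0}"
    using assms by auto
  ultimately show False
    using fin finite_subset by blast
qed

lemma chebyshev_T_0: "chebyshev_T 0 = 1"
  by (simp add: chebyshev_T_def)

lemma poly_chebyshev_T:
  fixes t :: rat
  assumes "n > 0" "t \<noteq> 0"
  shows "poly (map_poly of_int (chebyshev_T n)) (t + inverse t) = t ^ n + inverse t ^ n"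
proof -
  let ?P = "\<lambda>p. \<forall>t::rat. t \<noteq> 0 \<longrightarrow>
        poly (map_poly of_int p) (t + inverse t) = t ^ n + inverse t ^ n"
  have "\<exists>!p. ?P p"
    using chebyshev_T_exists[of n] by (auto intro!: chebyshev_T_unique)
  then have "?P (THE p. ?P p)"
    by (rule theI')
  then show ?thesis
    using assms by (simp add: chebyshev_T_def)
qed

definition z_elem :: "nat \<Rightarrow> nat \<Rightarrow> ratfun2" where
  "z_elem b c =
     (let y = cluster_var b c in
      if (b, c) = (2, 2) then y 0 * y 3 - y 1 * y 2
      else if (b, c) = (1, 4) then (y 0)\<^sup>2 * y 3 - (y 1 + 2) * (y 2)\<^sup>2
      else undefined)"

definition z_seq :: "nat \<Rightarrow> nat \<Rightarrow> nat \<Rightarrow> ratfun2" where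
  "z_seq b c n = poly (map_poly of_int (chebyshev_T n)) (z_elem b c)"

end

theory Submission
  imports Defs "HOL-Library.Multiset" "HOL-Computational_Algebra.Polynomial_Factorial"
begin

text \<open>Three facts make the cluster monomials and the elements \<open>z\<^sub>n\<close> a canonical basis: they span the
  cluster algebra, they are positive, and every one of them has a dual Laurent coefficient, that is, a
  monomial in some cluster that occurs in it with coefficient \<open>1\<close> and is absent from the other elements
  under consideration. Reading off dual coefficients gives linear independence, and shows that a
  positive element has nonnegative coordinates (\<open>is_canonical_basisI\<close>). A canonical basis is unique
  because its members are the positive elements that are not sums of two positive elements
  (\<open>basis_eq_indecomposables\<close>).

  In both cases the cluster variables, for \<open>(1, 4)\<close> only those with even index, form a sequence \<open>e\<close>
  with \<open>e (k - 1) + e (k + 1) = z * e k\<close>, where \<open>z\<close> is the same element for all clusters. With parameters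
  \<open>(1, 4)\<close> the variables with odd index are \<open>e k * e (k + 1) - 1\<close>. Everything is derived from this linear
  recursion.

  Positivity: in a cluster one has \<open>z = s + 1 / s + r\<close> with \<open>s\<close> a Laurent monomial and \<open>r\<close> a positive
  Laurent polynomial. Then \<open>w k = e (k + 1) - s * e k\<close> satisfies \<open>w (k + 1) = w k / s + r * e (k + 1)\<close>,
  so that \<open>e\<close> and \<open>w\<close> are computed together without subtraction. Likewise \<open>z\<^sub>n\<close> is the trace of
  the \<open>n\<close>-th power of a positive matrix with determinant \<open>1\<close> and trace \<open>z\<close>, whence
  \<open>z\<^sub>n = s ^ n + s ^ (- n) + \<rho>\<close> with \<open>\<rho>\<close> of smaller degree (\<open>chebyshev_trace_leading_terms\<close>).

  Dual coefficients: along the same recursions one controls the degrees of a distant cluster monomial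
  with respect to suitable weights of the two variables. For \<open>y m ^ p * y (m + 1) ^ q\<close> the dual monomial
  is itself: a cluster monomial not taken from this cluster has negative degree for some nonnegative
  weights, hence no monomial with two nonnegative exponents, and \<open>z\<^sub>n\<close> has none either. For \<open>z\<^sub>n\<close> the dual monomial is one of
  its two leading terms \<open>s ^ n\<close> and \<open>s ^ (- n)\<close>, in a cluster far to the left of all cluster monomials under consideration.

  Spanning: the variables \<open>e i\<close> and \<open>e j\<close> with \<open>j > i + 1\<close> satisfy \<open>e i * e j = e (i + 1) * e (j - 1) + D\<close>
  with \<open>D\<close> a polynomial in \<open>z\<close>, and repeated use of this relation reduces all products to
  products of two adjacent variables and polynomials in \<open>z\<close> (\<open>straightening\<close>).\<close>

section \<open>Laurent polynomials\<close>

lemma laurent_eval_superset: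
  assumes "finite S" "Poly_Mapping.keys f \<subseteq> S"
  shows "laurent_eval f u v = (\<Sum>k\<in>S. of_int (Poly_Mapping.lookup f k) * u powi fst k * v powi snd k)"
  unfolding laurent_eval_def using assms
  by (intro sum.mono_neutral_left) (auto simp: in_keys_iff)

lemma laurent_eval_0: "laurent_eval 0 u v = 0"
  by (simp add: laurent_eval_def)

lemma laurent_eval_single:
  "laurent_eval (Poly_Mapping.single k c) u v = of_int c * u powi fst k * v powi snd k"
  by (simp add: laurent_eval_superset[of "{k}"])

lemma laurent_eval_add: "laurent_eval (f + g) u v = laurent_eval f u v + laurent_eval g u v"
proof -
  let ?S = "Poly_Mapping.keys f \<union> Poly_Mapping.keys g"
  have "Poly_Mapping.keys (f + g) \<subseteq> ?S"
    by (rule Poly_Mapping.keys_add)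
  then show ?thesis
    by (simp add: laurent_eval_superset[of ?S] lookup_add distrib_right sum.distrib)
qed

lemma laurent_eval_cmul: "laurent_eval (frag_cmul c f) u v = of_int c * laurent_eval f u v"
proof -
  have "Poly_Mapping.keys (frag_cmul c f) \<subseteq> Poly_Mapping.keys f"
    by (rule keys_cmul)
  then have "laurent_eval (frag_cmul c f) u v = (\<Sum>k\<in>Poly_Mapping.keys f.
      of_int c * (of_int (Poly_Mapping.lookup f k) * u powi fst k * v powi snd k))"
    by (subst laurent_eval_superset[of "Poly_Mapping.keys f"]) (simp_all only: finite_keys
      lookup_frag_cmul of_int_mult mult.assoc)
  then show ?thesis
    by (simp only: laurent_eval_def sum_distrib_left)
qed

lemma laurent_eval_sum:
  "laurent_eval (\<Sum>x\<in>S. F x) u v = (\<Sum>x\<in>S. laurent_eval (F x) u v)"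
  by (induction S rule: infinite_finite_induct) (simp_all add: laurent_eval_0 laurent_eval_add)

lemma lookup_sum_cmul:
  "Poly_Mapping.lookup (\<Sum>x\<in>S. frag_cmul (a x) (F x)) k = (\<Sum>x\<in>S. a x * Poly_Mapping.lookup (F x) k)"
  by (induction S rule: infinite_finite_induct) (simp_all add: lookup_add)

definition laurent_independent :: "ratfun2 \<Rightarrow> ratfun2 \<Rightarrow> bool" where
  "laurent_independent u v \<longleftrightarrow> (\<forall>f. laurent_eval f u v = 0 \<longrightarrow> f = 0)"

lemma laurent_independent_eqD:
  assumes "laurent_independent u v" "laurent_eval f u v = laurent_eval g u v"
  shows "f = g"
proof -
  have "laurent_eval (f + frag_cmul (- 1) g) u v = 0"
    using assms(2) by (simp only: laurent_eval_add laurent_eval_cmul) simp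
  then have "f + frag_cmul (- 1) g = 0"
    using assms(1) unfolding laurent_independent_def by blast
  then show ?thesis
    by simp
qed

definition has_coeff :: "ratfun2 \<Rightarrow> ratfun2 \<Rightarrow> int \<times> int \<Rightarrow> ratfun2 \<Rightarrow> int \<Rightarrow> bool" where
  "has_coeff u v k x c \<longleftrightarrow> (\<exists>f. laurent_eval f u v = x \<and> Poly_Mapping.lookup f k = c)"

lemma has_coeff_add:
  "has_coeff u v k x c \<Longrightarrow> has_coeff u v k y d \<Longrightarrow> has_coeff u v k (x + y) (c + d)"
  unfolding has_coeff_def by (metis laurent_eval_add lookup_add)

lemma has_coeff_monomial:
  "has_coeff u v k (u powi i * v powi j) (if k = (i, j) then 1 else 0)"
  unfolding has_coeff_def
  by (rule exI[of _ "Poly_Mapping.single (i, j) 1"])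
    (auto simp: laurent_eval_single lookup_single when_def)

lemma has_coeff_other_monomial:
  "k \<noteq> (i, j) \<Longrightarrow> has_coeff u v k (u powi i * v powi j) 0"
  using has_coeff_monomial[of u v k i j] by (simp only: if_False)

lemma has_coeff_unique:
  assumes "laurent_independent u v" "has_coeff u v k x c" "has_coeff u v k x d"
  shows "c = d"
  using assms laurent_independent_eqD unfolding has_coeff_def by blast

text \<open>Positivity and a degree bound in one predicate: both pass to sums and to products, so a
  recursion without signs proves them together. The degree of a monomial is its weight
  \<open>\<alpha> * i + \<beta> * j\<close>, and a bound on it excludes a whole half plane of exponents.\<close>

inductive_set nonneg_laurent :: "ratfun2 \<Rightarrow> ratfun2 \<Rightarrow> int \<Rightarrow> int \<Rightarrow> int \<Rightarrow> ratfun2 set"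
  for u v :: ratfun2 and \<alpha> \<beta> d :: int where
  zero: "0 \<in> nonneg_laurent u v \<alpha> \<beta> d"
| add_monomial: "x \<in> nonneg_laurent u v \<alpha> \<beta> d \<Longrightarrow> c \<ge> 0 \<Longrightarrow> \<alpha> * i + \<beta> * j \<le> d \<Longrightarrow>
    of_int c * u powi i * v powi j + x \<in> nonneg_laurent u v \<alpha> \<beta> d"

lemma nonneg_laurent_monomial:
  "\<alpha> * i + \<beta> * j \<le> d \<Longrightarrow> u powi i * v powi j \<in> nonneg_laurent u v \<alpha> \<beta> d"
  using nonneg_laurent.add_monomial[OF nonneg_laurent.zero, of 1 \<alpha> i \<beta> j d u v] by simp

lemma nonneg_laurent_add:
  assumes "x \<in> nonneg_laurent u v \<alpha> \<beta> d" "y \<in> nonneg_laurent u v \<alpha> \<beta> d"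
  shows "x + y \<in> nonneg_laurent u v \<alpha> \<beta> d"
  using assms(1)
  by induction (use assms(2) in \<open>auto simp: add.assoc intro: nonneg_laurent.add_monomial\<close>)

lemma nonneg_laurent_mono:
  assumes "x \<in> nonneg_laurent u v \<alpha> \<beta> d" "d \<le> d'"
  shows "x \<in> nonneg_laurent u v \<alpha> \<beta> d'"
  using assms(1) by induction (use assms(2) in \<open>auto intro: nonneg_laurent.intros\<close>)

lemma nonneg_laurent_swap:
  assumes "x \<in> nonneg_laurent u v \<alpha> \<beta> d"
  shows "x \<in> nonneg_laurent v u \<beta> \<alpha> d"
  using assms
proof induction
  case (add_monomial x c i j)
  then have "of_int c * v powi j * u powi i + x \<in> nonneg_laurent v u \<beta> \<alpha> d"
    by (intro nonneg_laurent.add_monomial) (auto simp: add.commute)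
  then show ?case
    by (simp add: mult_ac)
qed (rule nonneg_laurent.zero)

lemma nonneg_laurent_mult:
  assumes "u \<noteq> 0" "v \<noteq> 0"
  assumes "x \<in> nonneg_laurent u v \<alpha> \<beta> d" "y \<in> nonneg_laurent u v \<alpha> \<beta> d'"
  shows "x * y \<in> nonneg_laurent u v \<alpha> \<beta> (d + d')"
  using assms(3)
proof induction
  case (add_monomial x c i j)
  have "(of_int c * u powi i * v powi j) * y \<in> nonneg_laurent u v \<alpha> \<beta> (d + d')"
    using assms(4)
  proof induction
    case (add_monomial y c' i' j')
    have "\<alpha> * (i + i') + \<beta> * (j + j') \<le> d + d'"
      using \<open>\<alpha> * i + \<beta> * j \<le> d\<close> \<open>\<alpha> * i' + \<beta> * j' \<le> d'\<close>
      by (simp only: distrib_left)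
    moreover have "c * c' \<ge> 0"
      using add_monomial \<open>c \<ge> 0\<close> by simp
    ultimately have "of_int (c * c') * u powi (i + i') * v powi (j + j')
        + of_int c * u powi i * v powi j * y \<in> nonneg_laurent u v \<alpha> \<beta> (d + d')"
      using add_monomial.IH by (intro nonneg_laurent.add_monomial)
    moreover have "of_int (c * c') * u powi (i + i') * v powi (j + j') =
        of_int c * u powi i * v powi j * (of_int c' * u powi i' * v powi j')"
      using power_int_add[of u i i'] power_int_add[of v j j'] assms(1,2)
      by (simp only: of_int_mult mult_ac simp_thms)
    ultimately show ?case
      by (simp only: distrib_left)
  qed (simp add: nonneg_laurent.zero)
  then show ?case
    using add_monomial.IH by (simp add: distrib_right nonneg_laurent_add)
qed (simp add: nonneg_laurent.zero)

lemma nonneg_laurent_one: "0 \<le> d \<Longrightarrow> 1 \<in> nonneg_laurent u v \<alpha> \<beta> d"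
  using nonneg_laurent_monomial[of \<alpha> 0 \<beta> 0 d u v] by simp

lemma nonneg_laurent_power:
  assumes "u \<noteq> 0" "v \<noteq> 0" "x \<in> nonneg_laurent u v \<alpha> \<beta> d"
  shows "x ^ n \<in> nonneg_laurent u v \<alpha> \<beta> (int n * d)"
proof (induction n)
  case (Suc n)
  then show ?case
    using nonneg_laurent_mult[OF assms(1,2,3) Suc] by (simp add: algebra_simps)
qed (simp add: nonneg_laurent_one)

lemma nonneg_laurent_expansion:
  assumes "x \<in> nonneg_laurent u v \<alpha> \<beta> d"
  shows "\<exists>f. laurent_eval f u v = x \<and> (\<forall>k. Poly_Mapping.lookup f k \<ge> 0) \<and>
    (\<forall>k\<in>Poly_Mapping.keys f. \<alpha> * fst k + \<beta> * snd k \<le> d)"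
  using assms
proof induction
  case zero
  show ?case
    by (rule exI[of _ 0]) (simp add: laurent_eval_0)
next
  case (add_monomial x c i j)
  then obtain f where f: "laurent_eval f u v = x" "\<And>k. Poly_Mapping.lookup f k \<ge> 0"
    "\<And>k. k \<in> Poly_Mapping.keys f \<Longrightarrow> \<alpha> * fst k + \<beta> * snd k \<le> d"
    by blast
  let ?g = "Poly_Mapping.single (i, j) c + f"
  have "Poly_Mapping.keys ?g \<subseteq> insert (i, j) (Poly_Mapping.keys f)"
    using Poly_Mapping.keys_add[of "Poly_Mapping.single (i, j) c" f] by (auto split: if_splits)
  then have "\<forall>k\<in>Poly_Mapping.keys ?g. \<alpha> * fst k + \<beta> * snd k \<le> d"
    using f(3) add_monomial.hyps by auto
  moreover have "\<forall>k. Poly_Mapping.lookup ?g k \<ge> 0"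
    using f(2) add_monomial.hyps by (simp add: lookup_add lookup_single when_def)
  moreover have "laurent_eval ?g u v = of_int c * u powi i * v powi j + x"
    by (simp add: laurent_eval_add laurent_eval_single f)
  ultimately show ?case
    by blast
qed

lemma has_coeff_nonneg_laurent:
  assumes "x \<in> nonneg_laurent u v \<alpha> \<beta> d" "d < \<alpha> * fst k + \<beta> * snd k"
  shows "has_coeff u v k x 0"
proof -
  from nonneg_laurent_expansion[OF assms(1)] obtain f where
    f: "laurent_eval f u v = x" "\<And>k. k \<in> Poly_Mapping.keys f \<Longrightarrow> \<alpha> * fst k + \<beta> * snd k \<le> d"
    by blast
  have "Poly_Mapping.lookup f k = 0"
    using f(2)[of k] assms(2) by (auto simp: in_keys_iff)
  then show ?thesis
    using f(1) has_coeff_def by blast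
qed

section \<open>Algebraic independence of a cluster\<close>

text \<open>Written with a double sum over a square so that the two elements play symmetric roles.\<close>

definition alg_independent :: "ratfun2 \<Rightarrow> ratfun2 \<Rightarrow> bool" where
  "alg_independent u v \<longleftrightarrow> (\<forall>n (a :: nat \<Rightarrow> nat \<Rightarrow> int).
     (\<Sum>i\<le>n. \<Sum>j\<le>n. of_int (a i j) * u ^ i * v ^ j) = 0 \<longrightarrow> (\<forall>i\<le>n. \<forall>j\<le>n. a i j = 0))"

lemma alg_independent_swap:
  assumes "alg_independent u v"
  shows "alg_independent v u"
  unfolding alg_independent_def
proof (intro allI impI)
  fix n i j and a :: "nat \<Rightarrow> nat \<Rightarrow> int"
  assume z: "(\<Sum>i\<le>n. \<Sum>j\<le>n. of_int (a i j) * v ^ i * u ^ j) = 0" and ij: "i \<le> n" "j \<le> n"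
  have "(\<Sum>j\<le>n. \<Sum>i\<le>n. of_int (a i j) * u ^ j * v ^ i) = 0"
    using z by (subst sum.swap) (simp add: mult_ac)
  then show "a i j = 0"
    using assms ij unfolding alg_independent_def by (elim allE[of _ n] allE[of _ "\<lambda>j i. a i j"]) auto
qed

lemma alg_independent_vars: "alg_independent var1 var2"
  unfolding alg_independent_def
proof (intro allI impI)
  fix n i j and a :: "nat \<Rightarrow> nat \<Rightarrow> int"
  assume z: "(\<Sum>i\<le>n. \<Sum>j\<le>n. of_int (a i j) * var1 ^ i * var2 ^ j) = 0" and ij: "i \<le> n" "j \<le> n"
  define m :: "nat \<Rightarrow> nat \<Rightarrow> rat poly poly" where
    "m i j = monom (monom (of_int (a i j)) i) j" for i j
  have pow: "to_fract p ^ k = to_fract (p ^ k)" for p :: "rat poly poly" and k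
    by (induction k) simp_all
  have oi: "of_int k = to_fract (of_int k :: rat poly poly)" for k
    by (cases k rule: int_cases2) (simp_all add: of_nat_fract to_fract_def)
  have v: "var1 = to_fract [:[:0, 1:]:]" "var2 = to_fract [:0, 1:]"
    by (simp_all add: var1_def var2_def to_fract_def)
  have "m i j = of_int (a i j) * [:[:0, 1:]:] ^ i * [:0, 1:] ^ j" for i j
  proof -
    have "[:[:0, 1:]:] ^ i = [:monom 1 i :: rat poly:]"
      by (induction i) (simp_all add: monom_Suc one_pCons)
    moreover have "[:0, 1:] ^ j = (monom 1 j :: rat poly poly)"
      by (simp add: monom_altdef)
    moreover have "of_int k = [:[:of_int k :: rat:]:]" for k
      by (simp add: of_int_poly)
    ultimately show ?thesis
      by (simp add: m_def smult_monom)
  qed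
  then have "to_fract (\<Sum>i\<le>n. \<Sum>j\<le>n. m i j) = to_fract 0"
    using z by (simp only: v pow oi to_fract_0 flip: to_fract_mult to_fract_sum)
  then have "(\<Sum>i\<le>n. \<Sum>j\<le>n. m i j) = 0"
    by (simp only: to_fract_eq_iff)
  then have "coeff (coeff (\<Sum>i\<le>n. \<Sum>j\<le>n. m i j) j) i = 0"
    by simp
  moreover have "coeff (coeff (\<Sum>i'\<le>n. \<Sum>j'\<le>n. m i' j') j) i = of_int (a i j)"
  proof -
    have "coeff (coeff (m i' j') j) i = (if j' = j then (if i' = i then of_int (a i j) else 0) else 0)" for i' j'
      by (simp add: m_def)
    then show ?thesis
      using ij by (simp add: coeff_sum)
  qed
  ultimately show "a i j = 0"
    by simp
qed

lemma map_poly_of_int_add: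
  "map_poly of_int (p + q) = map_poly of_int p + (map_poly of_int q :: 'a :: comm_ring_1 poly)"
  by (intro poly_eqI) (simp add: coeff_map_poly)

lemma map_poly_of_int_mult:
  "map_poly of_int (p * q) = map_poly of_int p * (map_poly of_int q :: 'a :: comm_ring_1 poly)"
  by (intro poly_eqI) (simp add: coeff_map_poly coeff_mult)

lemma poly_map_of_int_eq_sum:
  fixes v :: "'a :: comm_ring_1"
  assumes "degree p \<le> m"
  shows "poly (map_poly of_int p) v = (\<Sum>j\<le>m. of_int (coeff p j) * v ^ j)"
proof -
  let ?p = "map_poly of_int p :: 'a poly"
  have "degree ?p \<le> m"
    using assms map_poly_degree_leq[of "of_int :: int \<Rightarrow> 'a" p] by (simp add: order.trans)
  then have "(\<Sum>j\<le>m. coeff ?p j * v ^ j) = (\<Sum>j\<le>degree ?p. coeff ?p j * v ^ j)"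
    by (intro sum.mono_neutral_right) (auto simp: coeff_eq_0)
  then show ?thesis
    by (simp add: poly_altdef coeff_map_poly)
qed

text \<open>Substituting \<open>w = (v ^ e + 1) / u\<close> into a polynomial relation between \<open>w\<close> and \<open>v\<close> and
  clearing denominators turns the coefficient \<open>p\<close> of \<open>w ^ i\<close>, a polynomial in \<open>v\<close>, into the
  coefficient \<open>p * (X ^ e + 1) ^ i\<close> of \<open>u ^ (n - i)\<close>; multiplication by \<open>X ^ e + 1\<close> is
  injective.\<close>

lemma alg_independent_exchange:
  assumes "alg_independent u v" "u * w = v ^ e + 1" "e > 0"
  shows "alg_independent w v"
  unfolding alg_independent_def
proof (intro allI impI)
  fix n i j and a :: "nat \<Rightarrow> nat \<Rightarrow> int"
  assume z: "(\<Sum>i\<le>n. \<Sum>j\<le>n. of_int (a i j) * w ^ i * v ^ j) = 0" and ij: "i \<le> n" "j \<le> n"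
  let ?ev = "\<lambda>p :: int poly. poly (map_poly of_int p) v"
  define X :: "int poly" where "X = monom 1 e + 1"
  define p :: "nat \<Rightarrow> int poly" where "p i = (\<Sum>j\<le>n. monom (a i j) j)" for i
  define q where "q i = p i * X ^ i" for i
  have ev_mult: "?ev (r * s) = ?ev r * ?ev s" for r s
    by (simp add: map_poly_of_int_mult)
  have evX: "?ev (X ^ k) = (u * w) ^ k" for k
  proof (induction k)
    case (Suc k)
    have "?ev X = u * w"
      using assms(2) by (simp add: X_def map_poly_of_int_add map_poly_monom poly_monom)
    then show ?case
      using Suc by (simp add: ev_mult)
  qed simp
  have coeff_p: "coeff (p i) j = (if j \<le> n then a i j else 0)" for i j
    by (simp add: p_def coeff_sum)
  have evp: "?ev (p i) = (\<Sum>j\<le>n. of_int (a i j) * v ^ j)" for i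
    by (subst poly_map_of_int_eq_sum[of _ n]) (auto intro: degree_le simp: coeff_p)
  define m where "m = n + (\<Sum>i\<le>n. degree (q i))"
  have deg: "degree (q i) \<le> m" if "i \<le> n" for i
    using that member_le_sum[of i "{..n}" "\<lambda>i. degree (q i)"] by (simp add: m_def)
  \<comment> \<open>coefficients of the relation between \<open>u\<close> and \<open>v\<close>, padded with zeros to a square\<close>
  define b where "b k j = (if k \<le> n then coeff (q (n - k)) j else 0)" for k j
  have "(\<Sum>k\<le>m. \<Sum>j\<le>m. of_int (b k j) * u ^ k * v ^ j) =
      (\<Sum>k\<le>m. if k \<in> {..n} then u ^ k * ?ev (q (n - k)) else 0)"
    by (intro sum.cong refl)
      (simp add: b_def poly_map_of_int_eq_sum[OF deg] sum_distrib_left mult_ac)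
  also have "\<dots> = (\<Sum>k\<le>n. u ^ k * ?ev (q (n - k)))"
    by (subst sum.inter_restrict[symmetric]) (auto simp: m_def intro!: sum.cong)
  also have "\<dots> = (\<Sum>i\<le>n. u ^ (n - i) * ?ev (q i))"
    by (rule sum.reindex_bij_witness[of _ "\<lambda>i. n - i" "\<lambda>i. n - i"]) auto
  also have "\<dots> = (\<Sum>i\<le>n. u ^ n * (\<Sum>j\<le>n. of_int (a i j) * w ^ i * v ^ j))"
  proof (intro sum.cong refl)
    fix i assume "i \<in> {..n}"
    then have "u ^ (n - i) * (u * w) ^ i = u ^ n * w ^ i"
      by (simp add: power_mult_distrib flip: power_add mult.assoc)
    then have "u ^ (n - i) * ?ev (q i) = u ^ n * (w ^ i * ?ev (p i))"
      by (simp add: q_def ev_mult evX mult_ac)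
    then show "u ^ (n - i) * ?ev (q i) = u ^ n * (\<Sum>j\<le>n. of_int (a i j) * w ^ i * v ^ j)"
      by (simp add: evp sum_distrib_left mult_ac)
  qed
  also have "\<dots> = 0"
    using z by (simp flip: sum_distrib_left)
  finally have b0: "b k j = 0" if "k \<le> m" "j \<le> m" for k j
    using assms(1) that unfolding alg_independent_def by blast
  have "coeff (q i) k = 0" for k
  proof (cases "k \<le> m")
    case True
    then show ?thesis
      using b0[of "n - i" k] ij by (simp add: b_def m_def)
  qed (use deg[OF ij(1)] in \<open>auto intro: coeff_eq_0\<close>)
  then have "q i = 0"
    by (simp add: poly_eq_iff)
  moreover have "coeff X e = 1"
    using \<open>e > 0\<close> by (simp add: X_def)
  then have "X \<noteq> 0"
    by auto
  ultimately have "p i = 0"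
    by (simp add: q_def)
  then show "a i j = 0"
    using coeff_p[of i j] ij by simp
qed

text \<open>A Laurent relation becomes a polynomial one after multiplication by a high power of both
  elements.\<close>

lemma laurent_independentI:
  assumes "alg_independent u v" "u \<noteq> 0" "v \<noteq> 0"
  shows "laurent_independent u v"
  unfolding laurent_independent_def
proof (intro allI impI)
  fix f assume f: "laurent_eval f u v = 0"
  obtain N :: nat where N: "\<bar>fst k\<bar> \<le> int N \<and> \<bar>snd k\<bar> \<le> int N" if "k \<in> Poly_Mapping.keys f" for k
  proof
    fix k assume k: "k \<in> Poly_Mapping.keys f"
    let ?h = "\<lambda>k. nat \<bar>fst k\<bar> + nat \<bar>snd k\<bar>"
    have "?h k \<le> (\<Sum>k\<in>Poly_Mapping.keys f. ?h k)"
      using k by (intro member_le_sum) auto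
    then show "\<bar>fst k\<bar> \<le> int (\<Sum>k\<in>Poly_Mapping.keys f. ?h k) \<and>
        \<bar>snd k\<bar> \<le> int (\<Sum>k\<in>Poly_Mapping.keys f. ?h k)"
      by linarith
  qed
  let ?g = "\<lambda>(i, j). (int i - int N, int j - int N)"
  define a where "a i j = Poly_Mapping.lookup f (?g (i, j))" for i j
  have inj: "inj_on ?g S" for S
    by (auto simp: inj_on_def)
  have sub: "Poly_Mapping.keys f \<subseteq> ?g ` ({..2 * N} \<times> {..2 * N})"
  proof
    fix k assume "k \<in> Poly_Mapping.keys f"
    then have "k = ?g (nat (fst k + int N), nat (snd k + int N))"
      "nat (fst k + int N) \<le> 2 * N" "nat (snd k + int N) \<le> 2 * N"
      using N[of k] by (auto simp: prod_eq_iff)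
    then show "k \<in> ?g ` ({..2 * N} \<times> {..2 * N})"
      by blast
  qed
  have shift: "u powi (int i - int N) * u ^ N = u ^ i" if "u \<noteq> 0" for u :: ratfun2 and i
    using that by (simp add: power_int_diff)
  have "laurent_eval f u v = (\<Sum>k\<in>?g ` ({..2 * N} \<times> {..2 * N}).
      of_int (Poly_Mapping.lookup f k) * u powi fst k * v powi snd k)"
    by (rule laurent_eval_superset[OF _ sub]) simp
  also have "\<dots> = (\<Sum>(i, j)\<in>{..2 * N} \<times> {..2 * N}.
      of_int (a i j) * u powi (int i - int N) * v powi (int j - int N))"
    by (subst sum.reindex[OF inj]) (simp add: a_def case_prod_unfold o_def)
  finally have "0 = (\<Sum>(i, j)\<in>{..2 * N} \<times> {..2 * N}.
      of_int (a i j) * u powi (int i - int N) * v powi (int j - int N)) * (u ^ N * v ^ N)"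
    using f by simp
  also have "\<dots> = (\<Sum>(i, j)\<in>{..2 * N} \<times> {..2 * N}. of_int (a i j) *
      (u powi (int i - int N) * u ^ N) * (v powi (int j - int N) * v ^ N))"
    by (simp only: sum_distrib_right case_prod_unfold) (simp only: mult_ac)
  also have "\<dots> = (\<Sum>i\<le>2 * N. \<Sum>j\<le>2 * N. of_int (a i j) * u ^ i * v ^ j)"
    unfolding shift[OF assms(2)] shift[OF assms(3)] by (rule sum.cartesian_product[symmetric])
  finally have "(\<Sum>i\<le>2 * N. \<Sum>j\<le>2 * N. of_int (a i j) * u ^ i * v ^ j) = 0"
    by (rule sym)
  then have a0: "\<forall>i\<le>2 * N. \<forall>j\<le>2 * N. a i j = 0"
    by (rule assms(1)[unfolded alg_independent_def, THEN spec[of _ "2 * N"], THEN spec[of _ a], THEN mp])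
  have "Poly_Mapping.keys f = {}"
  proof (rule ccontr)
    assume "Poly_Mapping.keys f \<noteq> {}"
    then obtain k where k: "k \<in> Poly_Mapping.keys f"
      by blast
    then obtain i j where "k = ?g (i, j)" "i \<le> 2 * N" "j \<le> 2 * N"
      using sub by auto
    then show False
      using a0 k by (simp add: a_def in_keys_iff)
  qed
  then show "f = 0"
    by simp
qed

section \<open>Linear recursions preserve positivity\<close>

text \<open>The trace of the \<open>n\<close>-th power of a matrix with determinant \<open>1\<close> and trace \<open>z\<close>. Unlike
  the polynomial \<open>T\<^sub>0 = 1\<close>, the value at \<open>0\<close> is \<open>2\<close>, so that the recursion has no exception.\<close>

fun chebyshev_trace :: "'a :: comm_ring_1 \<Rightarrow> nat \<Rightarrow> 'a" where
  "chebyshev_trace z 0 = 2"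
| "chebyshev_trace z (Suc 0) = z"
| "chebyshev_trace z (Suc (Suc n)) = z * chebyshev_trace z (Suc n) - chebyshev_trace z n"

text \<open>A solution of \<open>f (i + 2) = z * f (i + 1) - f i\<close> involves a subtraction, but when
  \<open>z = s + 1 / s + r\<close> the differences \<open>w i = f (i + 1) - s * f i\<close> satisfy a recursion without
  signs.\<close>

lemma linear_recursion_ladder:
  fixes f :: "nat \<Rightarrow> 'a :: comm_ring_1"
  assumes "s * s' = 1" "z = s + s' + r" "\<And>i. f i + f (Suc (Suc i)) = z * f (Suc i)"
  shows "f (Suc (Suc i)) - s * f (Suc i) = s' * (f (Suc i) - s * f i) + r * f (Suc i)"
proof -
  have "f (Suc (Suc i)) = z * f (Suc i) - f i"
    using assms(3)[of i] by (simp add: algebra_simps)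
  moreover have "s' * (s * f i) = f i"
    using assms(1) by (simp add: mult.commute flip: mult.assoc)
  ultimately show ?thesis
    using assms(2) by (simp add: algebra_simps)
qed

text \<open>The bounds on the degrees of \<open>f\<close> fall by \<open>h\<close> in each step, those on the degrees of \<open>w\<close> rise by
  \<open>h\<close>. The first persist as long as they are not overtaken by the second.\<close>

lemma ladder_bounds:
  assumes nz: "u \<noteq> 0" "v \<noteq> 0"
    and f_Suc: "\<And>i. f (Suc i) = s * f i + w i"
    and w_Suc: "\<And>i. w (Suc i) = s' * w i + r * f (Suc i)"
    and s: "s \<in> nonneg_laurent u v \<alpha> \<beta> (- h)"
    and s': "s' \<in> nonneg_laurent u v \<alpha> \<beta> h"
    and r: "r \<in> nonneg_laurent u v \<alpha> \<beta> (- A - C)"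
    and f0: "f 0 \<in> nonneg_laurent u v \<alpha> \<beta> A"
    and w0: "w 0 \<in> nonneg_laurent u v \<alpha> \<beta> (- C)"
    and h: "h \<ge> 0"
  shows "2 * h * int i \<le> A + C + h \<Longrightarrow> f i \<in> nonneg_laurent u v \<alpha> \<beta> (A - h * int i) \<and>
    w i \<in> nonneg_laurent u v \<alpha> \<beta> (h * int i - C)"
proof (induction i)
  case 0
  show ?case
    using f0 w0 by simp
next
  case (Suc i)
  define p where "p = h * int i"
  have p: "p \<ge> 0" "h * int (Suc i) = p + h" "2 * h * int (Suc i) = 2 * p + 2 * h"
    "2 * h * int i = 2 * p"
    using h by (simp_all add: p_def algebra_simps)
  have f: "f i \<in> nonneg_laurent u v \<alpha> \<beta> (A - p)" and w: "w i \<in> nonneg_laurent u v \<alpha> \<beta> (p - C)"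
    using Suc h p by (simp_all add: p_def)
  have "s * f i + w i \<in> nonneg_laurent u v \<alpha> \<beta> (A - (p + h))"
    using nonneg_laurent_mult[OF nz s f] w Suc.prems p
    by (intro nonneg_laurent_add) (auto elim!: nonneg_laurent_mono)
  then have f': "f (Suc i) \<in> nonneg_laurent u v \<alpha> \<beta> (A - (p + h))"
    by (simp add: f_Suc)
  have "s' * w i + r * f (Suc i) \<in> nonneg_laurent u v \<alpha> \<beta> (p + h - C)"
    using nonneg_laurent_mult[OF nz s' w] nonneg_laurent_mult[OF nz r f'] h p
    by (intro nonneg_laurent_add) (auto elim!: nonneg_laurent_mono)
  then show ?case
    using f' unfolding p(2) by (simp add: w_Suc)
qed

text \<open>Subtracting \<open>1\<close> from the products of neighbours stays positive: the constant term \<open>1\<close> is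
  already contained in \<open>f 0 * w 0\<close> and is handed on by the recursion.\<close>

lemma product_ladder_bounds:
  assumes nz: "u \<noteq> 0" "v \<noteq> 0"
    and f_Suc: "\<And>i. f (Suc i) = s * f i + w i"
    and w_Suc: "\<And>i. w (Suc i) = s' * w i + r * f (Suc i)"
    and ss': "s * s' = 1"
    and s: "s \<in> nonneg_laurent u v \<alpha> \<beta> (- 2)"
    and s': "s' \<in> nonneg_laurent u v \<alpha> \<beta> 2"
    and r: "r \<in> nonneg_laurent u v \<alpha> \<beta> (- 2 * int n)"
    and f0: "f 0 \<in> nonneg_laurent u v \<alpha> \<beta> (int n)"
    and w0: "w 0 \<in> nonneg_laurent u v \<alpha> \<beta> (- int n)"
    and fw0: "f 0 * w 0 - 1 \<in> nonneg_laurent u v \<alpha> \<beta> (- 2)"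
    and i: "2 * i \<le> n"
  shows "f i * f (Suc i) - 1 \<in> nonneg_laurent u v \<alpha> \<beta> (max (- 2) (2 * int n - 4 * int i - 2))"
proof -
  have f: "f j \<in> nonneg_laurent u v \<alpha> \<beta> (int n - 2 * int j)"
    and w: "w j \<in> nonneg_laurent u v \<alpha> \<beta> (2 * int j - int n)" if "2 * j \<le> n" for j
    using ladder_bounds[where f = f and w = w and A = "int n" and C = "int n" and i = j,
        OF nz f_Suc w_Suc s s'] r f0 w0 that by simp_all
  have "2 * i \<le> n \<Longrightarrow> f i * w i - 1 \<in> nonneg_laurent u v \<alpha> \<beta> (- 2)"
  proof (induction i)
    case (Suc i)
    have "f (Suc i) * w (Suc i) - 1 = (s * f i + w i) * s' * w i + r * (f (Suc i))\<^sup>2 - 1"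
      by (simp add: w_Suc f_Suc algebra_simps power2_eq_square)
    also have "\<dots> = (s * s') * (f i * w i) + s' * (w i)\<^sup>2 + r * (f (Suc i))\<^sup>2 - 1"
      by (simp add: algebra_simps power2_eq_square)
    finally have eq: "f (Suc i) * w (Suc i) - 1 =
        (f i * w i - 1) + (s' * (w i * w i) + r * (f (Suc i) * f (Suc i)))"
      using ss' by (simp add: algebra_simps power2_eq_square)
    have le: "2 * i \<le> n"
      using Suc.prems by simp
    have "s' * (w i * w i) \<in> nonneg_laurent u v \<alpha> \<beta> (- 2)"
      using nonneg_laurent_mult[OF nz s' nonneg_laurent_mult[OF nz w[OF le] w[OF le]]] Suc.prems
      by (auto elim!: nonneg_laurent_mono)
    moreover have "r * (f (Suc i) * f (Suc i)) \<in> nonneg_laurent u v \<alpha> \<beta> (- 2)"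
      using nonneg_laurent_mult[OF nz r nonneg_laurent_mult[OF nz f[OF Suc.prems] f[OF Suc.prems]]]
      by (auto elim!: nonneg_laurent_mono)
    ultimately show ?case
      unfolding eq using Suc.IH[OF le] by (intro nonneg_laurent_add)
  qed (simp add: fw0)
  then have g: "f i * w i - 1 \<in> nonneg_laurent u v \<alpha> \<beta> (max (- 2) (2 * int n - 4 * int i - 2))"
    using i by (auto elim!: nonneg_laurent_mono)
  have "s * (f i * f i) \<in> nonneg_laurent u v \<alpha> \<beta> (max (- 2) (2 * int n - 4 * int i - 2))"
    using nonneg_laurent_mult[OF nz s nonneg_laurent_mult[OF nz f[OF i] f[OF i]]]
    by (auto elim!: nonneg_laurent_mono)
  then have "s * (f i * f i) + (f i * w i - 1) \<in>
      nonneg_laurent u v \<alpha> \<beta> (max (- 2) (2 * int n - 4 * int i - 2))"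
    using g by (rule nonneg_laurent_add)
  then show ?thesis
    by (simp add: f_Suc algebra_simps)
qed

text \<open>With \<open>z = s + s' + r\<close> and \<open>s * s' = 1\<close>, the matrix with rows \<open>(s + r, s')\<close> and \<open>(r, s')\<close>
  has determinant \<open>1\<close> and trace \<open>z\<close>, so by Cayley and Hamilton the traces of its powers are the
  Chebyshev elements; its entries are positive. When \<open>s\<close> has weight \<open>0\<close> and \<open>r\<close> has negative
  weight, the matrix is triangular up to terms of negative weight, which is why only the powers
  \<open>s ^ n\<close> and \<open>s' ^ n\<close> of its diagonal survive in weight \<open>0\<close>.\<close>

lemma chebyshev_trace_leading_terms:
  assumes nz: "u \<noteq> 0" "v \<noteq> 0"
    and z: "z = s + s' + r" "s * s' = 1"
    and s: "s \<in> nonneg_laurent u v \<alpha> \<beta> 0"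
    and s': "s' \<in> nonneg_laurent u v \<alpha> \<beta> 0"
    and r: "r \<in> nonneg_laurent u v \<alpha> \<beta> (- 1)"
  shows "\<exists>\<rho>\<in>nonneg_laurent u v \<alpha> \<beta> (- 1). chebyshev_trace z n = s ^ n + s' ^ n + \<rho>"
proof -
  let ?L = "nonneg_laurent u v \<alpha> \<beta>"
  have neg: "x * y \<in> ?L (- 1)" if "x \<in> ?L 0" "y \<in> ?L (- 1)" for x y
    using nonneg_laurent_mult[OF nz that] by simp
  have weak: "x \<in> ?L 0" if "x \<in> ?L (- 1)" for x
    using that by (rule nonneg_laurent_mono) simp
  have "\<exists>a b c d. a \<in> ?L (- 1) \<and> b \<in> ?L 0 \<and> c \<in> ?L (- 1) \<and> d \<in> ?L (- 1) \<and>
      chebyshev_trace z n = (s ^ n + a) + (s' ^ n + d) \<and>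
      chebyshev_trace z (Suc n) = (s ^ n + a) * (s + r) + b * r + (c + (s' ^ n + d)) * s'"
  proof (induction n)
    case 0
    show ?case
      by (intro exI[of _ 0]) (simp add: z nonneg_laurent.zero)
  next
    case (Suc n)
    then obtain a b c d where L: "a \<in> ?L (- 1)" "b \<in> ?L 0" "c \<in> ?L (- 1)" "d \<in> ?L (- 1)" and
      t: "chebyshev_trace z n = (s ^ n + a) + (s' ^ n + d)"
      "chebyshev_trace z (Suc n) = (s ^ n + a) * (s + r) + b * r + (c + (s' ^ n + d)) * s'"
      by blast
    define p q where "p = s ^ n" and "q = s' ^ n"
    have pq: "p \<in> ?L 0" "q \<in> ?L 0"
      using nonneg_laurent_power[OF nz s, of n] nonneg_laurent_power[OF nz s', of n]
      by (simp_all add: p_def q_def)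
    define a' b' c' d' where "a' = s * a + (p + a) * r + b * r" and "b' = (p + a + b) * s'"
      and "c' = (s + r) * c + (q + d) * r" and "d' = s' * (c + d)"
    have diag: "(s ^ n + a) * (s + r) + b * r = s ^ Suc n + a'"
      "(c + (s' ^ n + d)) * s' = s' ^ Suc n + d'"
      by (simp_all add: a'_def d'_def p_def algebra_simps)
    have L0: "a \<in> ?L 0" "c \<in> ?L 0" "d \<in> ?L 0" "r \<in> ?L 0"
      using L r by (simp_all add: weak)
    have "a' \<in> ?L (- 1)" "c' \<in> ?L (- 1)" "d' \<in> ?L (- 1)"
      unfolding a'_def c'_def d'_def using L L0 pq s r s'
      by (simp_all add: neg nonneg_laurent_add)
    moreover have "b' \<in> ?L 0"
      using nonneg_laurent_mult[OF nz, of "p + a + b" \<alpha> \<beta> 0 s' 0] L pq s'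
      by (simp add: b'_def nonneg_laurent_add weak)
    moreover have "chebyshev_trace z (Suc n) = (s ^ Suc n + a') + (s' ^ Suc n + d')"
      by (simp only: t(2) diag)
    moreover have "chebyshev_trace z (Suc (Suc n)) =
        (s ^ Suc n + a') * (s + r) + b' * r + (c' + (s' ^ Suc n + d')) * s'"
    proof -
      have "chebyshev_trace z (Suc (Suc n)) =
          (s + s' + r) * ((p + a) * (s + r) + b * r + (c + (q + d)) * s') - ((p + a) + (q + d)) * (s * s')"
        unfolding chebyshev_trace.simps t p_def q_def by (simp add: z(1) z(2))
      also have "\<dots> = ((p + a) * (s + r) + b * r) * (s + r) + b' * r + (c' + (c + (q + d)) * s') * s'"
        unfolding b'_def c'_def by (simp add: algebra_simps)
      finally show ?thesis
        by (simp only: p_def q_def diag)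
    qed
    ultimately show ?case
      by blast
  qed
  then obtain a d where "a \<in> ?L (- 1)" "d \<in> ?L (- 1)"
    "chebyshev_trace z n = (s ^ n + a) + (s' ^ n + d)"
    by blast
  then show ?thesis
    by (intro bexI[of _ "a + d"]) (auto simp: nonneg_laurent_add)
qed

section \<open>The exchange patterns with parameters (2, 2) and (1, 4)\<close>

definition exchange_22 :: "(int \<Rightarrow> 'a :: field) \<Rightarrow> bool" where
  "exchange_22 Y \<longleftrightarrow> (\<forall>k. Y k \<noteq> 0 \<and> Y (k - 1) * Y (k + 1) = (Y k)\<^sup>2 + 1)"

definition exchange_14 :: "(int \<Rightarrow> 'a :: field) \<Rightarrow> bool" where
  "exchange_14 Y \<longleftrightarrow> (\<forall>k. Y k \<noteq> 0 \<and> Y (k - 1) * Y (k + 1) = Y k ^ (if odd k then 1 else 4) + 1)"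

text \<open>The expansions of \<open>z\<close> in the cluster \<open>(Y 1, Y 2)\<close>.\<close>

definition z_22 :: "(int \<Rightarrow> 'a :: field) \<Rightarrow> 'a" where
  "z_22 Y = ((Y 1)\<^sup>2 + (Y 2)\<^sup>2 + 1) / (Y 1 * Y 2)"

definition z_14 :: "(int \<Rightarrow> 'a :: field) \<Rightarrow> 'a" where
  "z_14 Y = (Y 2 ^ 4 + (Y 1 + 1)\<^sup>2) / (Y 1 * (Y 2)\<^sup>2)"

lemma exchange_22_shift:
  assumes "exchange_22 Y"
  shows "exchange_22 (\<lambda>k. Y (j + k))"
  unfolding exchange_22_def
proof
  fix k
  show "Y (j + k) \<noteq> 0 \<and> Y (j + (k - 1)) * Y (j + (k + 1)) = (Y (j + k))\<^sup>2 + 1"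
    using assms[unfolded exchange_22_def, rule_format, of "j + k"] by (simp add: algebra_simps)
qed

lemma exchange_22_reflect:
  assumes "exchange_22 Y"
  shows "exchange_22 (\<lambda>k. Y (j - k))"
  unfolding exchange_22_def
proof
  fix k
  show "Y (j - k) \<noteq> 0 \<and> Y (j - (k - 1)) * Y (j - (k + 1)) = (Y (j - k))\<^sup>2 + 1"
    using assms[unfolded exchange_22_def, rule_format, of "j - k"] by (simp add: algebra_simps)
qed

lemma exchange_14_shift:
  assumes "exchange_14 Y"
  shows "exchange_14 (\<lambda>k. Y (2 * j + k))"
  unfolding exchange_14_def
proof
  fix k
  show "Y (2 * j + k) \<noteq> 0 \<and> Y (2 * j + (k - 1)) * Y (2 * j + (k + 1)) =
      Y (2 * j + k) ^ (if odd k then 1 else 4) + 1"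
    using assms[unfolded exchange_14_def, rule_format, of "2 * j + k"] by (simp add: algebra_simps)
qed

lemma exchange_14_reflect:
  assumes "exchange_14 Y"
  shows "exchange_14 (\<lambda>k. Y (2 * j - k))"
  unfolding exchange_14_def
proof
  fix k
  show "Y (2 * j - k) \<noteq> 0 \<and> Y (2 * j - (k - 1)) * Y (2 * j - (k + 1)) =
      Y (2 * j - k) ^ (if odd k then 1 else 4) + 1"
    using assms[unfolded exchange_14_def, rule_format, of "2 * j - k"] by (simp add: algebra_simps)
qed

lemma z_22_eq:
  assumes "exchange_22 Y"
  shows "z_22 Y * Y 1 = Y 0 + Y 2" "z_22 Y * Y 2 = Y 1 + Y 3"
proof -
  have nz: "Y 1 \<noteq> 0" "Y 2 \<noteq> 0" and ex: "Y 0 * Y 2 = (Y 1)\<^sup>2 + 1" "Y 1 * Y 3 = (Y 2)\<^sup>2 + 1"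
    using assms[unfolded exchange_22_def, rule_format, of 1]
      assms[unfolded exchange_22_def, rule_format, of 2] by simp_all
  have "z_22 Y = ((Y 2)\<^sup>2 + Y 0 * Y 2) / (Y 1 * Y 2)" "z_22 Y = ((Y 1)\<^sup>2 + Y 1 * Y 3) / (Y 1 * Y 2)"
    unfolding z_22_def ex by (simp_all add: add_ac)
  note eq = this
  have "((Y 2)\<^sup>2 + Y 0 * Y 2) / (Y 1 * Y 2) * Y 1 = Y 0 + Y 2"
    "((Y 1)\<^sup>2 + Y 1 * Y 3) / (Y 1 * Y 2) * Y 2 = Y 1 + Y 3"
    using nz by (simp_all add: divide_simps power2_eq_square algebra_simps)
  then show "z_22 Y * Y 1 = Y 0 + Y 2" "z_22 Y * Y 2 = Y 1 + Y 3"
    by (simp_all only: eq(1)[symmetric] eq(2)[symmetric])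
qed

text \<open>The second formula is symmetric in the two neighbours of \<open>Y 1\<close> and so gives the invariance of \<open>z\<close>
  under reflection at the index \<open>1\<close>. The first is symmetric about the index \<open>2\<close>. The two reflections
  together generate the translations by \<open>2\<close>.\<close>

lemma z_14_eq:
  assumes "exchange_14 Y"
  shows "z_14 Y * Y 2 = Y 0 + Y 4" "z_14 Y = ((Y 0)\<^sup>2 + (Y 2)\<^sup>2) / Y 1"
proof -
  have nz: "Y 1 \<noteq> 0" "Y 2 \<noteq> 0" and
    ex: "Y 0 * Y 2 = Y 1 + 1" "Y 1 * Y 3 = Y 2 ^ 4 + 1" "Y 2 * Y 4 = Y 3 + 1"
    using assms[unfolded exchange_14_def, rule_format, of 1]
      assms[unfolded exchange_14_def, rule_format, of 2]
      assms[unfolded exchange_14_def, rule_format, of 3] by simp_all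
  have "z_14 Y = (Y 2 ^ 4 + (Y 0 * Y 2)\<^sup>2) / (Y 1 * (Y 2)\<^sup>2)"
    unfolding z_14_def ex ..
  also have "\<dots> = ((Y 0)\<^sup>2 + (Y 2)\<^sup>2) / Y 1"
    using nz by (simp add: divide_simps) (simp add: algebra_simps power2_eq_square power4_eq_xxxx)
  finally show "z_14 Y = ((Y 0)\<^sup>2 + (Y 2)\<^sup>2) / Y 1" .
  have "z_14 Y * Y 2 * (Y 1 * Y 2) = Y 2 ^ 4 + (Y 1 + 1)\<^sup>2"
    using nz by (simp add: z_14_def field_simps power2_eq_square)
  also have "\<dots> = Y 1 * (Y 0 * Y 2 + Y 2 * Y 4)"
  proof -
    have "Y 2 ^ 4 = Y 1 * Y 3 - 1"
      using ex by simp
    then show ?thesis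
      by (simp add: ex algebra_simps power2_eq_square)
  qed
  finally have "z_14 Y * Y 2 * (Y 1 * Y 2) = (Y 0 + Y 4) * (Y 1 * Y 2)"
    by (simp add: algebra_simps)
  then show "z_14 Y * Y 2 = Y 0 + Y 4"
    using nz by simp
qed

lemma shift_invariant_const:
  fixes f :: "int \<Rightarrow> 'a"
  assumes "\<And>k. f (k + 1) = f k"
  shows "f k = f 0"
proof (induction k rule: int_induct[of _ 0])
  case (step2 k)
  then show ?case
    using assms[of "k - 1"] by simp
qed (use assms in simp_all)

text \<open>The right-hand sides in \<open>z_22_eq\<close> are the same expression for two adjacent clusters.\<close>

lemma z_22_shift: "exchange_22 Y \<Longrightarrow> z_22 (\<lambda>k. Y (j + k)) = z_22 Y"
proof -
  assume Y: "exchange_22 Y"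
  have "z_22 (\<lambda>k. Y (j + 1 + k)) = z_22 (\<lambda>k. Y (j + k))" for j
  proof -
    have "z_22 (\<lambda>k. Y (j + 1 + k)) * Y (j + 2) = z_22 (\<lambda>k. Y (j + k)) * Y (j + 2)"
      using z_22_eq(1)[OF exchange_22_shift[OF Y, of "j + 1"]]
        z_22_eq(2)[OF exchange_22_shift[OF Y, of j]] by (simp add: add.assoc)
    then show ?thesis
      using Y by (simp add: exchange_22_def)
  qed
  from shift_invariant_const[of "\<lambda>j. z_22 (\<lambda>k. Y (j + k))", OF this] show ?thesis
    by simp
qed

lemma z_14_reflect_aux: "exchange_14 Y \<Longrightarrow> z_14 (\<lambda>k. Y (2 - k)) = z_14 Y"
  using z_14_eq(2)[OF exchange_14_reflect[of Y 1]] z_14_eq(2)[of Y] by (simp add: add_ac)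

lemma z_14_shift: "exchange_14 Y \<Longrightarrow> z_14 (\<lambda>k. Y (2 * j + k)) = z_14 Y"
proof -
  assume Y: "exchange_14 Y"
  have "z_14 (\<lambda>k. Y (2 * (j + 1) + k)) = z_14 (\<lambda>k. Y (2 * j + k))" for j
  proof -
    have "z_14 (\<lambda>k. Y (2 * j + 4 - k)) * Y (2 * j + 2) = z_14 (\<lambda>k. Y (2 * j + k)) * Y (2 * j + 2)"
      using z_14_eq(1)[OF exchange_14_reflect[OF Y, of "j + 2"]]
        z_14_eq(1)[OF exchange_14_shift[OF Y, of j]] by (simp add: add_ac)
    then have "z_14 (\<lambda>k. Y (2 * j + 4 - k)) = z_14 (\<lambda>k. Y (2 * j + k))"
      using Y by (simp add: exchange_14_def)
    moreover have "z_14 (\<lambda>k. Y (2 * j + 4 - k)) = z_14 (\<lambda>k. Y (2 * (j + 1) + k))"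
      using z_14_reflect_aux[OF exchange_14_shift[OF Y, of "j + 1"]]
      by (simp add: algebra_simps)
    ultimately show ?thesis
      by simp
  qed
  from shift_invariant_const[of "\<lambda>j. z_14 (\<lambda>k. Y (2 * j + k))", OF this] show ?thesis
    by simp
qed

lemma z_14_reflect: "exchange_14 Y \<Longrightarrow> z_14 (\<lambda>k. Y (2 * j - k)) = z_14 Y"
  using z_14_shift[of "\<lambda>k. Y (2 - k)" "1 - j"] z_14_reflect_aux[of Y] exchange_14_reflect[of Y 1]
  by (simp add: algebra_simps)

lemma exchange_22_linear: "exchange_22 Y \<Longrightarrow> Y k + Y (k + 2) = z_22 Y * Y (k + 1)"
  using z_22_eq(1)[OF exchange_22_shift[of Y k]] z_22_shift[of Y k] by simp

lemma exchange_14_linear: "exchange_14 Y \<Longrightarrow> Y (2 * k) + Y (2 * k + 4) = z_14 Y * Y (2 * k + 2)"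
  using z_14_eq(1)[OF exchange_14_shift[of Y k]] z_14_shift[of Y k] by simp

section \<open>Cluster variables in a distant cluster\<close>

text \<open>The weight \<open>(n + 1, n)\<close> is the one for which \<open>Y (n + 2)\<close> has degree \<open>0\<close> and \<open>Y (n + 3)\<close>
  has degree \<open>-1\<close>: going down from these two values, the maximal degrees \<open>d\<close> must satisfy the
  tropical exchange relation \<open>d (k - 1) + d (k + 1) = max (2 * d k) 0\<close>, and at the indices \<open>1\<close>
  and \<open>2\<close> they take the values \<open>n + 1\<close> and \<open>n\<close>.\<close>

lemma exchange_22_degree:
  fixes n :: nat
  assumes "exchange_22 Y"
  defines "L \<equiv> nonneg_laurent (Y 1) (Y 2) (int n + 1) (int n)"
  shows "Y (int n + 2) \<in> L 0" "Y (int n + 3) \<in> L (- 1)"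
proof -
  have Y: "Y k \<noteq> 0" for k
    using assms(1) by (simp add: exchange_22_def)
  have mono: "Y 1 powi i * Y 2 powi j \<in> L d" if "(int n + 1) * i + int n * j \<le> d" for i j d
    unfolding L_def using that by (rule nonneg_laurent_monomial)
  define s s' r where "s = Y 2 / Y 1" and "s' = Y 1 / Y 2" and "r = 1 / (Y 1 * Y 2)"
  define f where "f i = Y (int i + 2)" for i
  define w where "w i = f (Suc i) - s * f i" for i
  have z: "s * s' = 1" "z_22 Y = s + s' + r"
    using Y by (simp_all add: s_def s'_def r_def z_22_def divide_simps power2_eq_square)
  have "f i + f (Suc (Suc i)) = z_22 Y * f (Suc i)" for i
    using exchange_22_linear[OF assms(1), of "int i + 2"] by (simp add: f_def algebra_simps)
  then have w_Suc: "w (Suc i) = s' * w i + r * f (Suc i)" for i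
    unfolding w_def by (rule linear_recursion_ladder[OF z])
  have f_Suc: "f (Suc i) = s * f i + w i" for i
    by (simp add: w_def)
  have "Y 1 * Y 3 = (Y 2)\<^sup>2 + 1"
    using assms(1)[unfolded exchange_22_def, rule_format, of 2] by simp
  then have "Y 3 = ((Y 2)\<^sup>2 + 1) / Y 1"
    using Y[of 1] by (simp add: field_simps)
  then have w0: "w 0 = Y 1 powi (- 1) * Y 2 powi 0"
    using Y[of 1] by (simp add: w_def f_def s_def power_int_minus field_simps power2_eq_square)
  have s: "s = Y 1 powi (- 1) * Y 2 powi 1" "s' = Y 1 powi 1 * Y 2 powi (- 1)"
    "r = Y 1 powi (- 1) * Y 2 powi (- 1)" and f0: "f 0 = Y 1 powi 0 * Y 2 powi 1"
    by (simp_all add: s_def s'_def r_def f_def power_int_minus divide_inverse)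
  have L: "s \<in> L (- 1)" "s' \<in> L 1" "r \<in> L (- int n - (int n + 1))" "f 0 \<in> L (int n)"
    "w 0 \<in> L (- (int n + 1))"
    unfolding s f0 w0 by (intro mono; simp)+
  have f: "f i \<in> L (int n - int i)" if "i \<le> n + 1" for i
    using ladder_bounds[where f = f and w = w and h = 1 and A = "int n" and C = "int n + 1" and i = i,
      OF Y Y f_Suc w_Suc, of 1 2 "int n + 1" "int n"] L that by (simp add: L_def)
  show "Y (int n + 2) \<in> L 0" "Y (int n + 3) \<in> L (- 1)"
    using f[of n] f[of "Suc n"] by (simp_all add: f_def add_ac)
qed

lemma exchange_14_product:
  assumes "exchange_14 Y"
  shows "Y (2 * k) * Y (2 * k + 2) - 1 = Y (2 * k + 1)"
  using assms[unfolded exchange_14_def, rule_format, of "2 * k + 1"] by (simp add: add_ac)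

text \<open>Again the weights come from the tropical exchange relations, solved downwards from degree \<open>0\<close> at
  \<open>n + 2\<close> and a negative degree at \<open>n + 3\<close>; for even \<open>n\<close> they are doubled, which gives one formula
  for both parities.\<close>

lemma exchange_14_degree_right:
  fixes n :: nat
  assumes "exchange_14 Y"
  defines "L \<equiv> nonneg_laurent (Y 1) (Y 2) (2 * int n + 2) (int n)"
  shows "Y (int n + 2) \<in> L 0" "Y (int n + 3) \<in> L (- 1)"
proof -
  have Y: "Y k \<noteq> 0" for k
    using assms(1) by (simp add: exchange_14_def)
  have mono: "Y 1 powi i * Y 2 powi j \<in> L d" if "(2 * int n + 2) * i + int n * j \<le> d" for i j d
    unfolding L_def using that by (rule nonneg_laurent_monomial)
  define s s' r where "s = (Y 2)\<^sup>2 / Y 1" and "s' = Y 1 / (Y 2)\<^sup>2"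
    and "r = 1 / (Y 2)\<^sup>2 + 1 / (Y 2)\<^sup>2 + 1 / (Y 1 * (Y 2)\<^sup>2)"
  define f where "f i = Y (2 * int i + 2)" for i
  define w where "w i = f (Suc i) - s * f i" for i
  have z: "s * s' = 1" "z_14 Y = s + s' + r"
    using Y by (simp_all add: s_def s'_def r_def z_14_def divide_simps power2_eq_square)
      (simp add: algebra_simps power4_eq_xxxx)
  have "f i + f (Suc (Suc i)) = z_14 Y * f (Suc i)" for i
    using exchange_14_linear[OF assms(1), of "int i + 1"] by (simp add: f_def algebra_simps)
  then have w_Suc: "w (Suc i) = s' * w i + r * f (Suc i)" for i
    unfolding w_def by (rule linear_recursion_ladder[OF z])
  have f_Suc: "f (Suc i) = s * f i + w i" for i
    by (simp add: w_def)
  have "Y 1 * Y 3 = Y 2 ^ 4 + 1" "Y 2 * Y 4 = Y 3 + 1"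
    using assms(1)[unfolded exchange_14_def, rule_format, of 2]
      assms(1)[unfolded exchange_14_def, rule_format, of 3] by simp_all
  then have "Y 4 = (Y 2 ^ 4 + 1 + Y 1) / (Y 1 * Y 2)"
    using Y by (simp add: field_simps)
  moreover have "(v ^ 4 + 1 + u) / (u * v) - v\<^sup>2 / u * v = u powi (- 1) * v powi (- 1) + u powi 0 * v powi (- 1)"
    if "u \<noteq> 0" "v \<noteq> 0" for u v :: ratfun2
    using that by (simp add: power_int_minus divide_simps)
      (simp add: algebra_simps power2_eq_square power4_eq_xxxx)
  ultimately have w0: "w 0 = Y 1 powi (- 1) * Y 2 powi (- 1) + Y 1 powi 0 * Y 2 powi (- 1)"
    using Y by (simp add: w_def f_def s_def)
  have s: "s = Y 1 powi (- 1) * Y 2 powi 2" "s' = Y 1 powi 1 * Y 2 powi (- 2)"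
    "r = Y 1 powi 0 * Y 2 powi (- 2) + Y 1 powi 0 * Y 2 powi (- 2) + Y 1 powi (- 1) * Y 2 powi (- 2)"
    and f0: "f 0 = Y 1 powi 0 * Y 2 powi 1"
    by (simp_all add: s_def s'_def r_def f_def power_int_minus divide_inverse)
  have fw0: "f 0 * w 0 - 1 = Y 1 powi (- 1) * Y 2 powi 0"
    unfolding w0 using Y by (simp add: f_def power_int_minus field_simps)
  have sL: "s \<in> L (- 2)" and s'L: "s' \<in> L 2" and rL: "r \<in> L (- 2 * int n)"
    and f0L: "f 0 \<in> L (int n)" and w0L: "w 0 \<in> L (- int n)"
    unfolding s f0 w0 L_def by (intro nonneg_laurent_add mono[unfolded L_def]; simp)+
  have fw0L: "f 0 * w 0 - 1 \<in> L (- 2)"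
    unfolding fw0 by (rule mono) simp
  have f: "f i \<in> L (int n - 2 * int i)" if "2 * i \<le> n + 1" for i
    using ladder_bounds[where f = f and w = w and h = 2 and A = "int n" and C = "int n" and i = i,
      OF Y Y f_Suc w_Suc, of 1 2 "2 * int n + 2" "int n"] sL s'L rL f0L w0L that by (simp add: L_def)
  have g: "Y (2 * int i + 3) \<in> L (max (- 2) (2 * int n - 4 * int i - 2))" if "2 * i \<le> n" for i
    using product_ladder_bounds[where f = f and w = w and n = n and i = i,
      OF Y Y f_Suc w_Suc z(1), of 1 2 "2 * int n + 2" "int n"] sL s'L rL f0L w0L fw0L that
      exchange_14_product[OF assms(1), of "int i + 1"] by (simp add: L_def f_def algebra_simps)
  have weak: "x \<in> L d'" if "x \<in> L d" "d \<le> d'" for x d d'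
    using that unfolding L_def by (rule nonneg_laurent_mono)
  show "Y (int n + 2) \<in> L 0"
  proof (cases "even n")
    case True
    then obtain i where "n = 2 * i" by blast
    then show ?thesis
      using f[of i] by (simp add: f_def)
  next
    case False
    then obtain i where "n = 2 * i + 1" by (rule oddE)
    then show ?thesis
      using g[of i] by (auto elim!: weak simp: add_ac)
  qed
  show "Y (int n + 3) \<in> L (- 1)"
  proof (cases "even n")
    case True
    then obtain i where "n = 2 * i" by blast
    then show ?thesis
      using g[of i] by (auto elim!: weak)
  next
    case False
    then obtain i where "n = 2 * i + 1" by (rule oddE)
    then show ?thesis
      using f[of "i + 1"] by (auto elim!: weak simp: f_def add_ac)
  qed
qed

text \<open>The pattern is not symmetric under the exchange of \<open>Y 1\<close> and \<open>Y 2\<close>, so the variables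
  to the left need weights of their own. For them \<open>s\<close> and \<open>s'\<close> trade places.\<close>

lemma exchange_14_degree_left:
  fixes n :: nat
  assumes "exchange_14 Y"
  defines "L \<equiv> nonneg_laurent (Y 1) (Y 2) (2 * int n) (int n + 1)"
  shows "Y (1 - int n) \<in> L 0" "Y (- int n) \<in> L (- 1)"
proof -
  have Y: "Y k \<noteq> 0" for k
    using assms(1) by (simp add: exchange_14_def)
  have mono: "Y 1 powi i * Y 2 powi j \<in> L d" if "2 * int n * i + (int n + 1) * j \<le> d" for i j d
    unfolding L_def using that by (rule nonneg_laurent_monomial)
  define s s' r where "s = Y 1 / (Y 2)\<^sup>2" and "s' = (Y 2)\<^sup>2 / Y 1"
    and "r = 1 / (Y 2)\<^sup>2 + 1 / (Y 2)\<^sup>2 + 1 / (Y 1 * (Y 2)\<^sup>2)"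
  define f where "f i = Y (2 - 2 * int i)" for i
  define w where "w i = f (Suc i) - s * f i" for i
  have z: "s * s' = 1" "z_14 Y = s + s' + r"
    using Y by (simp_all add: s_def s'_def r_def z_14_def divide_simps power2_eq_square)
      (simp add: algebra_simps power4_eq_xxxx)
  have "f i + f (Suc (Suc i)) = z_14 Y * f (Suc i)" for i
  proof -
    have "2 * (- int i - 1) = 2 - 2 * int (Suc (Suc i))" "2 * (- int i - 1) + 4 = 2 - 2 * int i"
      "2 * (- int i - 1) + 2 = 2 - 2 * int (Suc i)"
      by simp_all
    then show ?thesis
      using exchange_14_linear[OF assms(1), of "- int i - 1"] unfolding f_def by (simp only: add.commute)
  qed
  then have w_Suc: "w (Suc i) = s' * w i + r * f (Suc i)" for i
    unfolding w_def by (rule linear_recursion_ladder[OF z])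
  have f_Suc: "f (Suc i) = s * f i + w i" for i
    by (simp add: w_def)
  have "Y 0 * Y 2 = Y 1 + 1"
    using assms(1)[unfolded exchange_14_def, rule_format, of 1] by simp
  then have "Y 0 = (Y 1 + 1) / Y 2"
    using Y by (simp add: field_simps)
  then have w0: "w 0 = Y 1 powi 0 * Y 2 powi (- 1)"
    using Y by (simp add: w_def f_def s_def power_int_minus divide_simps power2_eq_square)
  have s: "s = Y 1 powi 1 * Y 2 powi (- 2)" "s' = Y 1 powi (- 1) * Y 2 powi 2"
    "r = Y 1 powi 0 * Y 2 powi (- 2) + Y 1 powi 0 * Y 2 powi (- 2) + Y 1 powi (- 1) * Y 2 powi (- 2)"
    and f0: "f 0 = Y 1 powi 0 * Y 2 powi 1"
    by (simp_all add: s_def s'_def r_def f_def power_int_minus divide_inverse)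
  have fw0: "f 0 * w 0 - 1 = 0"
    unfolding w0 using Y by (simp add: f_def power_int_minus)
  have sL: "s \<in> L (- 2)" and s'L: "s' \<in> L 2" and rL: "r \<in> L (- 2 * int (n + 1))"
    and f0L: "f 0 \<in> L (int (n + 1))" and w0L: "w 0 \<in> L (- int (n + 1))"
    unfolding s f0 w0 L_def by (intro nonneg_laurent_add mono[unfolded L_def]; simp)+
  have fw0L: "f 0 * w 0 - 1 \<in> L (- 2)"
    unfolding fw0 L_def by (rule nonneg_laurent.zero)
  have f: "f i \<in> L (int (n + 1) - 2 * int i)" if "2 * i \<le> n + 2" for i
    using ladder_bounds[where f = f and w = w and h = 2 and A = "int (n + 1)" and C = "int (n + 1)" and i = i,
      OF Y Y f_Suc w_Suc, of 1 2 "2 * int n" "int n + 1"] sL s'L rL f0L w0L that by (simp add: L_def)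
  have g: "Y (1 - 2 * int i) \<in> L (max (- 2) (2 * int (n + 1) - 4 * int i - 2))" if "2 * i \<le> n + 1" for i
    using product_ladder_bounds[where f = f and w = w and n = "n + 1" and i = i,
      OF Y Y f_Suc w_Suc z(1), of 1 2 "2 * int n" "int n + 1"] sL s'L rL f0L w0L fw0L that
      exchange_14_product[OF assms(1), of "- int i"] by (simp add: L_def f_def algebra_simps)
  have weak: "x \<in> L d'" if "x \<in> L d" "d \<le> d'" for x d d'
    using that unfolding L_def by (rule nonneg_laurent_mono)
  show "Y (1 - int n) \<in> L 0"
  proof (cases "even n")
    case True
    then obtain i where "n = 2 * i" by blast
    then show ?thesis
      using g[of i] by (auto elim!: weak)
  next
    case False
    then obtain i where "n = 2 * i + 1" by (rule oddE)
    then show ?thesis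
      using f[of "i + 1"] by (auto elim!: weak simp: f_def)
  qed
  show "Y (- int n) \<in> L (- 1)"
  proof (cases "even n")
    case True
    then obtain i where "n = 2 * i" by blast
    then show ?thesis
      using f[of "i + 1"] by (auto elim!: weak simp: f_def)
  next
    case False
    then obtain i where "n = 2 * i + 1" by (rule oddE)
    then show ?thesis
      using g[of "i + 1"] by (auto elim!: weak)
  qed
qed

lemma power_int_monomial_power:
  "(u powi i * v powi j) ^ n = u powi (int n * i) * v powi (int n * j :: int)"
  for u v :: "'a :: field"
  by (simp add: power_mult_distrib mult.commute[of "int n"] power_int_mult)

text \<open>The weights \<open>(1, 1)\<close> here and \<open>(2, 1)\<close> for the other pattern are those that give the leading
  monomial \<open>s\<close> of \<open>z\<close> the weight \<open>0\<close>.\<close>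

lemma exchange_22_chebyshev:
  assumes "exchange_22 Y"
  shows "\<exists>\<rho>\<in>nonneg_laurent (Y 1) (Y 2) 1 1 (- 1). chebyshev_trace (z_22 Y) n =
    Y 1 powi int n * Y 2 powi (- int n) + Y 1 powi (- int n) * Y 2 powi int n + \<rho>"
proof -
  have Y: "Y k \<noteq> 0" for k
    using assms by (simp add: exchange_22_def)
  define s s' r where "s = Y 1 powi 1 * Y 2 powi (- 1)" and "s' = Y 1 powi (- 1) * Y 2 powi 1"
    and "r = Y 1 powi (- 1) * Y 2 powi (- 1)"
  have "z_22 Y = s + s' + r" "s * s' = 1"
    using Y by (simp_all add: s_def s'_def r_def z_22_def power_int_minus divide_simps power2_eq_square)
  moreover have "s \<in> nonneg_laurent (Y 1) (Y 2) 1 1 0" "s' \<in> nonneg_laurent (Y 1) (Y 2) 1 1 0"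
    "r \<in> nonneg_laurent (Y 1) (Y 2) 1 1 (- 1)"
    unfolding s_def s'_def r_def by (intro nonneg_laurent_monomial; simp)+
  ultimately show ?thesis
    using chebyshev_trace_leading_terms[OF Y Y, of "z_22 Y" s s' r 1 2 1 1 n]
    unfolding s_def s'_def power_int_monomial_power by simp
qed

lemma exchange_14_chebyshev:
  assumes "exchange_14 Y"
  shows "\<exists>\<rho>\<in>nonneg_laurent (Y 1) (Y 2) 2 1 (- 1). chebyshev_trace (z_14 Y) n =
    Y 1 powi int n * Y 2 powi (- 2 * int n) + Y 1 powi (- int n) * Y 2 powi (2 * int n) + \<rho>"
proof -
  have Y: "Y k \<noteq> 0" for k
    using assms by (simp add: exchange_14_def)
  define s s' r where "s = Y 1 powi 1 * Y 2 powi (- 2)" and "s' = Y 1 powi (- 1) * Y 2 powi 2"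
    and "r = Y 1 powi 0 * Y 2 powi (- 2) + Y 1 powi 0 * Y 2 powi (- 2) + Y 1 powi (- 1) * Y 2 powi (- 2)"
  have "z_14 Y = s + s' + r" "s * s' = 1"
    using Y by (simp_all add: s_def s'_def r_def z_14_def power_int_minus divide_simps power2_eq_square)
      (simp add: algebra_simps power4_eq_xxxx)
  moreover have "s \<in> nonneg_laurent (Y 1) (Y 2) 2 1 0" "s' \<in> nonneg_laurent (Y 1) (Y 2) 2 1 0"
    "r \<in> nonneg_laurent (Y 1) (Y 2) 2 1 (- 1)"
    unfolding s_def s'_def r_def by (intro nonneg_laurent_add nonneg_laurent_monomial; simp)+
  ultimately show ?thesis
    using chebyshev_trace_leading_terms[OF Y Y, of "z_14 Y" s s' r 1 2 2 1 n]
    unfolding s_def s'_def power_int_monomial_power by (simp add: mult.commute[of _ "2::int"])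
qed

section \<open>Canonical bases and dual coefficients\<close>

lemma independent_eq_coeffs:
  assumes "zmod.independent B" "finite U" "U \<subseteq> B"
    and "(\<Sum>x\<in>U. of_int (a x) * x) = (\<Sum>x\<in>U. of_int (a' x) * x)" "x \<in> U"
  shows "a x = a' x"
proof -
  have "(\<Sum>x\<in>U. of_int (a x - a' x) * x) = 0"
    using assms(4) by (simp add: left_diff_distrib sum_subtractf)
  from zmod.independentD[OF assms(1-3) this assms(5)] show ?thesis
    by simp
qed

lemma positive_combinationsD:
  assumes "x \<in> positive_combinations B"
  shows "\<exists>S a. finite S \<and> S \<noteq> {} \<and> S \<subseteq> B \<and> (\<forall>s\<in>S. a s > (0 :: int)) \<and>
    x = (\<Sum>s\<in>S. of_int (a s) * s)"
  using assms unfolding positive_combinations_def by auto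

lemma basis_subset_positive_combinations: "B \<subseteq> positive_combinations B"
proof
  fix x assume "x \<in> B"
  then show "x \<in> positive_combinations B"
    unfolding positive_combinations_def
    by (intro CollectI exI[of _ "{x}"] exI[of _ "\<lambda>_. 1"]) simp
qed

text \<open>The coefficients of a positive combination are positive integers, so the sum of the
  coefficients of a sum of two of them is at least \<open>2\<close>. Hence a basis is recovered from its
  positive combinations as the set of those that do not split.\<close>

lemma basis_eq_indecomposables:
  assumes "zmod.independent B"
  shows "B = {x \<in> positive_combinations B.
    \<not> (\<exists>y\<in>positive_combinations B. \<exists>w\<in>positive_combinations B. x = y + w)}"
proof (intro equalityI subsetI CollectI conjI notI)
  fix x assume x: "x \<in> B"
  then show "x \<in> positive_combinations B"
    using basis_subset_positive_combinations by blast
  assume "\<exists>y\<in>positive_combinations B. \<exists>w\<in>positive_combinations B. x = y + w"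
  then obtain y w where yw: "y \<in> positive_combinations B" "w \<in> positive_combinations B" "x = y + w"
    by blast
  obtain S a where S: "finite S" "S \<noteq> {}" "S \<subseteq> B" "\<forall>s\<in>S. a s > (0 :: int)" and
    y: "y = (\<Sum>s\<in>S. of_int (a s) * s)"
    using positive_combinationsD[OF yw(1)] by (elim exE conjE)
  obtain T a' where T: "finite T" "T \<noteq> {}" "T \<subseteq> B" "\<forall>s\<in>T. a' s > (0 :: int)" and
    w: "w = (\<Sum>s\<in>T. of_int (a' s) * s)"
    using positive_combinationsD[OF yw(2)] by (elim exE conjE)
  let ?U = "insert x (S \<union> T)"
  let ?a = "\<lambda>s. if s \<in> S then a s else 0" and ?a' = "\<lambda>s. if s \<in> T then a' s else 0"
  have "(\<Sum>s\<in>S. of_int (a s) * s) = (\<Sum>s\<in>?U. of_int (?a s) * s)"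
    "(\<Sum>s\<in>T. of_int (a' s) * s) = (\<Sum>s\<in>?U. of_int (?a' s) * s)"
    using S(1) T(1) by (intro sum.mono_neutral_cong_left; auto)+
  then have "(\<Sum>s\<in>?U. of_int (?a s + ?a' s) * s) = x"
    unfolding yw(3) y w by (simp only: of_int_add distrib_right sum.distrib)
  also have "x = (\<Sum>s\<in>?U. of_int (if s = x then 1 else 0) * s)"
  proof -
    have "(\<Sum>s\<in>?U. of_int (if s = x then 1 else 0) * s) = (\<Sum>s\<in>?U. if s = x then s else 0)"
      by (intro sum.cong) auto
    then show ?thesis
      using S(1) T(1) by simp
  qed
  finally have "(\<Sum>s\<in>?U. of_int (?a s + ?a' s) * s) = (\<Sum>s\<in>?U. of_int (if s = x then 1 else 0) * s)" .
  then have coeff: "?a s + ?a' s = (if s = x then 1 else 0)" if "s \<in> ?U" for s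
    using independent_eq_coeffs[where a = "\<lambda>s. ?a s + ?a' s" and a' = "\<lambda>s. if s = x then 1 else 0",
        OF assms _ _ _ that] S T x by simp
  have nonneg: "?a s \<ge> 0" "?a' s \<ge> 0" for s
    using S(4) T(4) by (simp_all add: less_imp_le)
  obtain s t where "s \<in> S" "t \<in> T"
    using S(2) T(2) by blast
  moreover have "s = x"
    using coeff[of s] S(4)[rule_format, OF \<open>s \<in> S\<close>] nonneg(2)[of s] \<open>s \<in> S\<close> by (auto split: if_splits)
  moreover have "t = x"
    using coeff[of t] T(4)[rule_format, OF \<open>t \<in> T\<close>] nonneg(1)[of t] \<open>t \<in> T\<close> by (auto split: if_splits)
  ultimately show False
    using coeff[of x] S(4)[rule_format, of x] T(4)[rule_format, of x] by auto
next
  fix x assume "x \<in> {x \<in> positive_combinations B.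
    \<not> (\<exists>y\<in>positive_combinations B. \<exists>w\<in>positive_combinations B. x = y + w)}"
  then have x: "x \<in> positive_combinations B" and
    indec: "y \<in> positive_combinations B \<Longrightarrow> w \<in> positive_combinations B \<Longrightarrow> x \<noteq> y + w" for y w
    by blast+
  obtain S a where S: "finite S" "S \<noteq> {}" "S \<subseteq> B" "\<forall>s\<in>S. a s > (0 :: int)" and
    eq: "x = (\<Sum>s\<in>S. of_int (a s) * s)"
    using positive_combinationsD[OF x] by (elim exE conjE)
  have comb: "(\<Sum>s\<in>T. of_int (a' s) * s) \<in> positive_combinations B"
    if "finite T" "T \<noteq> {}" "T \<subseteq> B" "\<And>s. s \<in> T \<Longrightarrow> a' s > (0 :: int)" for T a'
    unfolding positive_combinations_def using that by blast
  obtain v where v: "v \<in> S"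
    using S(2) by blast
  have S_eq: "S = {v}"
  proof (rule ccontr)
    assume "S \<noteq> {v}"
    then have "S - {v} \<noteq> {}"
      using v by blast
    then have "(\<Sum>s\<in>S - {v}. of_int (a s) * s) \<in> positive_combinations B"
      using S by (intro comb) auto
    moreover have "(\<Sum>s\<in>{v}. of_int (a s) * s) \<in> positive_combinations B"
      using S v by (intro comb) auto
    ultimately show False
      using indec eq sum.remove[OF S(1) v, of "\<lambda>s. of_int (a s) * s"] by fastforce
  qed
  have "a v = 1"
  proof (rule ccontr)
    assume "a v \<noteq> 1"
    then have "a v > 1"
      using S(4)[rule_format, OF v] by simp
    then have "(\<Sum>s\<in>{v}. of_int (a s - 1) * s) \<in> positive_combinations B"
      using S v by (intro comb) auto
    moreover have "v \<in> positive_combinations B"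
      using S v basis_subset_positive_combinations by blast
    ultimately show False
      using indec[of "\<Sum>s\<in>{v}. of_int (a s - 1) * s" v] eq S_eq by (simp add: algebra_simps)
  qed
  then show "x \<in> B"
    using eq S_eq S(3) by simp
qed

lemma canonical_basis_unique:
  assumes "is_canonical_basis b c B" "is_canonical_basis b c B'"
  shows "B = B'"
proof -
  have "zmod.independent B" "zmod.independent B'" "positive_combinations B = positive_combinations B'"
    using assms by (simp_all add: is_canonical_basis_def)
  then show ?thesis
    using basis_eq_indecomposables[of B] basis_eq_indecomposables[of B'] by simp
qed

lemma canonical_basis_eqI:
  assumes "is_canonical_basis b c B"
  shows "canonical_basis b c = B"
  unfolding canonical_basis_def
  by (rule the_equality[where P = "is_canonical_basis b c",
        OF assms canonical_basis_unique[OF _ assms]])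

lemma cluster_algebra_0: "0 \<in> cluster_algebra b c"
  using cluster_algebra.diff[OF cluster_algebra.one cluster_algebra.one] by simp

lemma cluster_algebra_add:
  assumes "x \<in> cluster_algebra b c" "y \<in> cluster_algebra b c"
  shows "x + y \<in> cluster_algebra b c"
  using cluster_algebra.diff[OF assms(1) cluster_algebra.diff[OF cluster_algebra_0 assms(2)]] by simp

lemma cluster_algebra_of_int: "of_int k \<in> cluster_algebra b c"
proof (induction k rule: int_induct[of _ 0])
  case (step1 i)
  then show ?case
    using cluster_algebra_add[OF _ cluster_algebra.one] by simp
next
  case (step2 i)
  then show ?case
    using cluster_algebra.diff[OF _ cluster_algebra.one] by simp
qed (simp add: cluster_algebra_0)

lemma cluster_algebra_power: "x \<in> cluster_algebra b c \<Longrightarrow> x ^ n \<in> cluster_algebra b c"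
  by (induction n) (simp_all add: cluster_algebra.one cluster_algebra.mult)

lemma cluster_algebra_sum:
  "(\<And>i. i \<in> S \<Longrightarrow> f i \<in> cluster_algebra b c) \<Longrightarrow> (\<Sum>i\<in>S. f i) \<in> cluster_algebra b c"
  by (induction S rule: infinite_finite_induct) (auto simp: cluster_algebra_0 cluster_algebra_add)

text \<open>A Laurent coefficient that equals \<open>1\<close> on one basis element and vanishes on finitely many
  others reads off the coordinate belonging to that element. This gives linear independence at
  once; and since the coordinate is a Laurent coefficient of the expanded element, it is
  nonnegative when that element is positive.\<close>

lemma is_canonical_basisI:
  assumes indep: "\<And>m. laurent_independent (cluster_var b c m) (cluster_var b c (m + 1))"
    and span: "cluster_algebra b c \<subseteq> zmod.span B"
    and pos: "\<And>x. x \<in> B \<Longrightarrow> positive_element b c x"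
    and dual: "\<And>S s. finite S \<Longrightarrow> S \<subseteq> B \<Longrightarrow> s \<in> S \<Longrightarrow> \<exists>m k. \<forall>x\<in>S.
      has_coeff (cluster_var b c m) (cluster_var b c (m + 1)) k x (if x = s then 1 else 0)"
  shows "is_canonical_basis b c B"
proof -
  let ?y = "cluster_var b c"
  have coord: "\<exists>m k. has_coeff (?y m) (?y (m + 1)) k (\<Sum>x\<in>S. of_int (a x) * x) (a s)"
    if S: "finite S" "S \<subseteq> B" "s \<in> S" for S a s
  proof -
    obtain m k where "\<forall>x\<in>S. has_coeff (?y m) (?y (m + 1)) k x (if x = s then 1 else 0)"
      using dual[OF S] by blast
    then obtain F where F: "\<And>x. x \<in> S \<Longrightarrow> laurent_eval (F x) (?y m) (?y (m + 1)) = x"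
      "\<And>x. x \<in> S \<Longrightarrow> Poly_Mapping.lookup (F x) k = (if x = s then 1 else 0)"
      unfolding has_coeff_def by metis
    let ?g = "\<Sum>x\<in>S. frag_cmul (a x) (F x)"
    have "laurent_eval ?g (?y m) (?y (m + 1)) = (\<Sum>x\<in>S. of_int (a x) * x)"
      by (simp add: laurent_eval_sum laurent_eval_cmul F)
    moreover have "Poly_Mapping.lookup ?g k = a s"
      using S by (simp add: lookup_sum_cmul F(2) if_distrib[of "(*) _"] cong: if_cong)
    ultimately show ?thesis
      unfolding has_coeff_def by blast
  qed
  have "zmod.independent B"
    unfolding zmod.dependent_explicit
  proof clarify
    fix S a s assume S: "finite S" "S \<subseteq> B" "s \<in> S" "(\<Sum>x\<in>S. of_int (a x) * x) = 0" "a s \<noteq> 0"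
    obtain m k where "has_coeff (?y m) (?y (m + 1)) k 0 (a s)"
      using coord[OF S(1-3), of a] S(4) by auto
    moreover have "has_coeff (?y m) (?y (m + 1)) k 0 0"
      unfolding has_coeff_def by (rule exI[of _ 0]) (simp add: laurent_eval_0)
    ultimately show False
      using has_coeff_unique[OF indep] S(5) by blast
  qed
  note independent = this
  have B_sub: "B \<subseteq> cluster_algebra b c"
    using pos by (auto simp: positive_element_def)
  have "zmod.span B = cluster_algebra b c"
  proof (intro equalityI span zmod.span_minimal B_sub)
    show "zmod.subspace (cluster_algebra b c)"
      by (rule zmod.subspaceI)
        (auto intro: cluster_algebra_0 cluster_algebra_add cluster_algebra_of_int cluster_algebra.mult)
  qed
  moreover have "{x. positive_element b c x} = positive_combinations B"
  proof (intro equalityI subsetI)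
    fix x assume "x \<in> {x. positive_element b c x}"
    then have x: "positive_element b c x"
      by simp
    then have "x \<in> zmod.span B"
      using span by (auto simp: positive_element_def)
    then obtain S a where S: "finite S" "S \<subseteq> B" "x = (\<Sum>s\<in>S. of_int (a s) * s)"
      unfolding zmod.span_explicit by blast
    have "a s \<ge> 0" if s: "s \<in> S" for s
    proof -
      obtain m k where mk: "has_coeff (?y m) (?y (m + 1)) k x (a s)"
        using coord[OF S(1,2) s, of a] S(3) by blast
      obtain f where f: "laurent_eval f (?y m) (?y (m + 1)) = x"
        "\<forall>k\<in>Poly_Mapping.keys f. Poly_Mapping.lookup f k > 0"
        using x by (auto simp: positive_element_def)
      then have "a s = Poly_Mapping.lookup f k"
        using has_coeff_unique[OF indep mk] by (auto simp: has_coeff_def)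
      then show ?thesis
        using f(2)[rule_format, of k] by (cases "k \<in> Poly_Mapping.keys f") (auto simp: in_keys_iff)
    qed
    moreover define T where "T = {s \<in> S. a s \<noteq> 0}"
    ultimately have T: "\<And>s. s \<in> T \<Longrightarrow> a s > 0" "finite T" "T \<subseteq> B"
      using S by (force simp: T_def)+
    have eq: "x = (\<Sum>s\<in>T. of_int (a s) * s)"
      unfolding S(3) T_def using S(1) by (intro sum.mono_neutral_right) auto
    moreover have "T \<noteq> {}"
      using eq x by (auto simp: positive_element_def)
    ultimately show "x \<in> positive_combinations B"
      unfolding positive_combinations_def using T by blast
  next
    fix x assume "x \<in> positive_combinations B"
    from positive_combinationsD[OF this] obtain S a where S: "finite S" "S \<noteq> {}" "S \<subseteq> B" "\<forall>s\<in>S. a s > (0 :: int)" and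
      eq: "x = (\<Sum>s\<in>S. of_int (a s) * s)"
      by (elim exE conjE)
    obtain s where s: "s \<in> S"
      using S(2) by blast
    have "x \<noteq> 0"
      using zmod.independentD[OF independent S(1,3) _ s, of a] S(4)[rule_format, OF s] unfolding eq by auto
    moreover have "x \<in> cluster_algebra b c"
      unfolding eq using S(3) B_sub
      by (intro cluster_algebra_sum cluster_algebra.mult cluster_algebra_of_int) auto
    moreover have "\<exists>f. laurent_eval f (?y m) (?y (m + 1)) = x \<and>
        (\<forall>k\<in>Poly_Mapping.keys f. Poly_Mapping.lookup f k > 0)" for m
    proof -
      have "\<forall>x\<in>S. \<exists>f. laurent_eval f (?y m) (?y (m + 1)) = x \<and> (\<forall>k. Poly_Mapping.lookup f k \<ge> 0)"
      proof
        fix x assume "x \<in> S"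
        then obtain f where f: "laurent_eval f (?y m) (?y (m + 1)) = x"
          "\<forall>k\<in>Poly_Mapping.keys f. Poly_Mapping.lookup f k > 0"
          using S(3) pos[of x] by (auto simp: positive_element_def)
        then show "\<exists>f. laurent_eval f (?y m) (?y (m + 1)) = x \<and> (\<forall>k. Poly_Mapping.lookup f k \<ge> 0)"
          by (metis in_keys_iff less_imp_le order_refl)
      qed
      then obtain F where F: "\<And>x. x \<in> S \<Longrightarrow> laurent_eval (F x) (?y m) (?y (m + 1)) = x"
        "\<And>x k. x \<in> S \<Longrightarrow> Poly_Mapping.lookup (F x) k \<ge> 0"
        by metis
      define g where "g = (\<Sum>x\<in>S. frag_cmul (a x) (F x))"
      have "Poly_Mapping.lookup g k \<ge> 0" for k
        unfolding g_def lookup_sum_cmul using S(4) F(2)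
        by (intro sum_nonneg mult_nonneg_nonneg) (auto intro: less_imp_le)
      then have "\<forall>k\<in>Poly_Mapping.keys g. Poly_Mapping.lookup g k > 0"
        by (simp add: in_keys_iff order_less_le)
      moreover have "laurent_eval g (?y m) (?y (m + 1)) = x"
        by (simp add: g_def laurent_eval_sum laurent_eval_cmul F eq)
      ultimately show ?thesis
        by blast
    qed
    ultimately show "x \<in> {x. positive_element b c x}"
      by (simp add: positive_element_def)
  qed
  ultimately show ?thesis
    using independent by (simp add: is_canonical_basis_def)
qed

section \<open>Straightening products\<close>

definition product_at :: "(int \<Rightarrow> 'a :: comm_monoid_mult) \<Rightarrow> int multiset \<Rightarrow> 'a" where
  "product_at e M = prod_mset (image_mset e M)"

lemma product_at_simps [simp]:
  "product_at e {#} = 1" "product_at e (add_mset k M) = e k * product_at e M"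
  "product_at e (M + N) = product_at e M * product_at e N"
  by (simp_all add: product_at_def)

text \<open>Products on which the straightening below stops: no two indices differ by more than \<open>1\<close>.\<close>

lemma adjacent_product_eq:
  assumes "\<forall>i\<in>#M. \<forall>l\<in>#M. l \<le> i + (1 :: int)"
  shows "\<exists>k p q. product_at e M = e k ^ p * e (k + 1) ^ q"
proof (cases "M = {#}")
  case True
  then have "product_at e M = e 0 ^ 0 * e (0 + 1) ^ 0"
    by simp
  then show ?thesis
    by blast
next
  case False
  define k where "k = Min (set_mset M)"
  have k: "k \<in># M" "\<And>i. i \<in># M \<Longrightarrow> k \<le> i"
    using False by (simp_all add: k_def)
  have mem: "i = k \<or> i = k + 1" if "i \<in># M" for i
  proof -
    have "i \<le> k + 1"
      using assms k(1) that by blast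
    then show ?thesis
      using k(2)[OF that] by linarith
  qed
  have "M = replicate_mset (count M k) k + replicate_mset (count M (k + 1)) (k + 1)"
  proof (rule multiset_eqI)
    fix i
    show "count M i = count (replicate_mset (count M k) k + replicate_mset (count M (k + 1)) (k + 1)) i"
      using mem[of i] by (cases "i \<in># M") (auto simp: not_in_iff)
  qed
  then have "product_at e M = product_at e (replicate_mset (count M k) k + replicate_mset (count M (k + 1)) (k + 1))"
    by (rule arg_cong)
  also have "\<dots> = e k ^ count M k * e (k + 1) ^ count M (k + 1)"
    unfolding product_at_def by simp
  finally show ?thesis
    by blast
qed

text \<open>Two indices that differ by more than \<open>1\<close> are moved towards each other. The correction \<open>D n\<close>
  obeys the same linear recursion as the variables, starts with \<open>0\<close> and \<open>\<delta>\<close>,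
  and is therefore \<open>\<delta>\<close> times a polynomial in \<open>z\<close>; the factors \<open>z\<close> are absorbed by the remaining
  variables through \<open>z * e k = e (k - 1) + e (k + 1)\<close>. The induction is on the number of
  variables, then on the power of \<open>z\<close>, then on the sum of the squares of the indices.\<close>

lemma straightening:
  fixes e :: "int \<Rightarrow> ratfun2"
  assumes lin: "\<And>k. e (k - 1) + e (k + 1) = z * e k"
    and ex: "\<And>k. e (k - 1) * e (k + 1) = (e k)\<^sup>2 + \<delta>"
    and \<delta>: "\<delta> = 1 \<or> \<delta> = z"
    and V: "zmod.subspace V" "\<And>j. z ^ j \<in> V" "\<And>k p q. e k ^ p * e (k + 1) ^ q \<in> V"
  shows "z ^ j * product_at e M \<in> V"
proof (induction "size M" arbitrary: M j rule: less_induct)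
  case less
  define n where "n = size M"
  have fewer: "z ^ j * product_at e N \<in> V" if "size N < n" for N j
    using less[of N j] that by (simp add: n_def)
  have V_add: "x + x' \<in> V" and V_diff: "x - x' \<in> V" if "x \<in> V" "x' \<in> V" for x x'
    using that V(1) by (simp_all add: zmod.subspace_add zmod.subspace_diff)
  have pure: "product_at e N \<in> V" if "size N = n" for N
    using that
  proof (induction "\<Sum>i\<in>#N. nat (i\<^sup>2)" arbitrary: N rule: less_induct)
    case (less N)
    show ?case
    proof (cases "\<forall>i\<in>#N. \<forall>l\<in>#N. l \<le> i + 1")
      case True
      then show ?thesis
        using adjacent_product_eq[of N e] V(3) by auto
    next
      case False
      then obtain i l where il: "i \<in># N" "l \<in># N" "l > i + 1"
        by auto
      then have "l \<in># N - {#i#}"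
        by (simp add: in_diff_count)
      then obtain R where N: "N = add_mset i (add_mset l R)"
        using il(1) by (metis insert_DiffM)
      define m where "m = nat (l - i - 1)"
      have m: "l = i + 1 + int m" "m > 0"
        using il(3) by (simp_all add: m_def)
      define D where "D k = e i * e (i + 1 + int k) - e (i + 1) * e (i + int k)" for k
      have D_rec: "D (Suc (Suc k)) = z * D (Suc k) - D k" for k
      proof -
        have step: "e (a + 2) = z * e (a + 1) - e a" for a
          using lin[of "a + 1"] by (simp add: algebra_simps)
        have "D (Suc (Suc k)) = e i * e (i + 1 + int k + 2) - e (i + 1) * e (i + int k + 2)"
          "D (Suc k) = e i * e (i + 1 + int k + 1) - e (i + 1) * e (i + int k + 1)"
          by (simp_all add: D_def add_ac)
        then show ?thesis
          unfolding step D_def[of k] by (simp add: right_diff_distrib mult_ac)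
      qed
      have D1: "D (Suc 0) = \<delta>"
        using ex[of "i + 1"] by (simp add: D_def power2_eq_square)
      have D_in: "z ^ j * D k * product_at e R \<in> V" for j k
      proof (induction k arbitrary: j rule: induct_nat_012)
        case 0
        then show ?case
          using V(1) by (simp add: D_def mult.commute zmod.subspace_0)
      next
        case 1
        have R: "z ^ j * product_at e R \<in> V" for j
          using fewer[of R j] less.prems by (simp add: N)
        show ?case
          using \<delta> R[of j] R[of "Suc j"] unfolding D1 by (auto simp: mult_ac)
      next
        case (ge2 k)
        have eq: "z ^ j * D (Suc (Suc k)) * product_at e R =
            z ^ Suc j * D (Suc k) * product_at e R - z ^ j * D k * product_at e R"
          by (simp add: D_rec algebra_simps)
        show ?case
          unfolding eq by (intro V_diff ge2.IH)
      qed
      have "nat ((i + 1)\<^sup>2) + nat ((l - 1)\<^sup>2) < nat (i\<^sup>2) + nat (l\<^sup>2)"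
      proof -
        have "(i + 1)\<^sup>2 + (l - 1)\<^sup>2 = i\<^sup>2 + l\<^sup>2 - 2 * int m"
          by (simp add: m power2_eq_square algebra_simps)
        then have "(i + 1)\<^sup>2 + (l - 1)\<^sup>2 < i\<^sup>2 + l\<^sup>2"
          using m by linarith
        moreover from this have "0 < i\<^sup>2 + l\<^sup>2"
          by (rule le_less_trans[rotated]) simp
        ultimately show ?thesis
          by (simp flip: nat_add_distrib)
      qed
      then have "product_at e (add_mset (i + 1) (add_mset (l - 1) R)) \<in> V"
        using less.prems by (intro less.hyps) (simp_all add: N)
      moreover have "product_at e N =
          product_at e (add_mset (i + 1) (add_mset (l - 1) R)) + z ^ 0 * D m * product_at e R"
        by (simp add: N D_def m algebra_simps)
      ultimately show ?thesis
        using D_in[of 0 m] V_add by metis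
    qed
  qed
  have "z ^ j * product_at e N \<in> V" if "size N = n" for N j
    using that
  proof (induction j arbitrary: N)
    case (Suc j)
    show ?case
    proof (cases "N = {#}")
      case True
      then show ?thesis
        using V(2)[of "Suc j"] by simp
    next
      case False
      then obtain k R where N: "N = add_mset k R"
        by (meson multiset_cases)
      have "z ^ Suc j * product_at e N = z ^ j * (z * e k) * product_at e R"
        by (simp add: N mult_ac)
      also have "\<dots> = z ^ j * product_at e (add_mset (k - 1) R) + z ^ j * product_at e (add_mset (k + 1) R)"
        by (simp add: lin[symmetric] algebra_simps)
      also have "\<dots> \<in> V"
        using Suc by (intro V_add Suc.IH) (simp_all add: N)
      finally show ?thesis .
    qed
  qed (use pure in simp)
  then show ?case
    by (simp add: n_def)
qed

lemma span_mult_closed: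
  assumes S: "\<And>x y. x \<in> S \<Longrightarrow> y \<in> S \<Longrightarrow> x * y \<in> S"
    and xy: "x \<in> zmod.span S" "y \<in> zmod.span S"
  shows "x * y \<in> zmod.span S"
proof -
  have "s * y \<in> zmod.span S" if s: "s \<in> S" for s
    using xy(2)
  proof (induction rule: zmod.span_induct_alt)
    case (step k x w)
    then have "of_int k * (s * x) + s * w \<in> zmod.span S"
      using S[OF s] by (intro zmod.span_add zmod.span_scale) (auto intro: zmod.span_base)
    then show ?case
      by (simp add: algebra_simps)
  qed (simp add: zmod.span_zero)
  note base = this
  show ?thesis
    using xy(1)
  proof (induction rule: zmod.span_induct_alt)
    case (step k x w)
    then have "of_int k * (x * y) + w * y \<in> zmod.span S"
      using base by (intro zmod.span_add zmod.span_scale)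
    then show ?case
      by (simp add: algebra_simps)
  qed (simp add: zmod.span_zero)
qed

lemma cluster_algebra_subset_span:
  assumes e: "\<And>m. cluster_var b c m \<in> zmod.span (range (product_at e))"
    and V: "zmod.subspace V" "\<And>M. product_at e M \<in> V"
  shows "cluster_algebra b c \<subseteq> V"
proof -
  have "cluster_algebra b c \<subseteq> zmod.span (range (product_at e))"
  proof
    fix x assume "x \<in> cluster_algebra b c"
    then show "x \<in> zmod.span (range (product_at e))"
    proof induction
      case one
      show ?case
        by (rule zmod.span_base) (auto intro: range_eqI[of _ _ "{#}"])
    next
      case (mult x y)
      have "x * y \<in> range (product_at e)" if xy: "x \<in> range (product_at e)" "y \<in> range (product_at e)" for x y
      proof -
        obtain M N where "x = product_at e M" "y = product_at e N"
          using xy by blast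
        then have "x * y = product_at e (M + N)"
          by simp
        then show ?thesis
          by blast
      qed
      then show ?case
        using span_mult_closed[OF _ mult.IH] by blast
    qed (use e in \<open>auto intro: zmod.span_diff\<close>)
  qed
  also have "\<dots> \<subseteq> V"
    using V by (intro zmod.span_minimal) auto
  finally show ?thesis .
qed

text \<open>The span is closed under multiplication by \<open>z\<close>, because \<open>z * T\<^sub>k = T\<^sub>k\<^sub>+\<^sub>1 + T\<^sub>k\<^sub>-\<^sub>1\<close>; the constant
  \<open>1\<close> is added to account for \<open>T\<^sub>0\<close>.\<close>

lemma powers_in_span_chebyshev:
  "z ^ n \<in> zmod.span (insert 1 {chebyshev_trace z k | k. k \<ge> 1})" for z :: ratfun2
proof -
  let ?V = "zmod.span (insert 1 {chebyshev_trace z k | k. k \<ge> 1})"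
  have cheb: "chebyshev_trace z k \<in> ?V" for k
  proof (cases "k = 0")
    case True
    have "of_int 2 * 1 \<in> ?V"
      by (intro zmod.span_scale zmod.span_base) simp
    then show ?thesis
      using True by simp
  qed (auto intro!: zmod.span_base)
  have "z * x \<in> ?V" if "x \<in> ?V" for x
    using that
  proof (induction rule: zmod.span_induct_alt)
    case (step k x w)
    have "z * x \<in> ?V"
    proof (cases "x = 1")
      case True
      then show ?thesis
        using cheb[of 1] by simp
    next
      case False
      then obtain j where "x = chebyshev_trace z (Suc j)"
        using step.hyps by (auto simp: Suc_le_eq gr0_conv_Suc)
      then have "z * x = chebyshev_trace z (Suc (Suc j)) + chebyshev_trace z j"
        by simp
      moreover have "\<dots> \<in> ?V"
        by (intro zmod.span_add cheb)
      ultimately show ?thesis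
        by (simp only:)
    qed
    then have "of_int k * (z * x) + z * w \<in> ?V"
      using step by (intro zmod.span_add zmod.span_scale)
    then show ?case
      by (simp add: algebra_simps)
  qed (simp add: zmod.span_zero)
  then show ?thesis
    by (induction n) (auto intro: zmod.span_base)
qed

section \<open>Dual coefficients for cluster monomials and Chebyshev elements\<close>

lemma cluster_var_nonzero: "cluster_var b c m \<noteq> 0"
  using cluster_var_pos[of b c m] by auto

text \<open>What the two patterns have in common. In every cluster \<open>(y m, y (m + 1))\<close>, the variables on either
  side are bounded with respect to nonnegative weights for which one member of the distant cluster has
  degree at most \<open>0\<close> and the farther one has negative degree; and \<open>z\<^sub>n\<close> has two opposite leading exponents \<open>\<plusminus>n * (i, j)\<close>
  of weight \<open>0\<close>. In odd clusters \<open>(i, j) = (1, - \<epsilon>)\<close>, and the condition \<open>\<epsilon> * \<beta> < \<alpha>\<close> says that this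
  exponent has positive weight, so that it does not occur in the cluster monomials to the right.\<close>

locale affine_pattern =
  fixes b c :: nat and z :: ratfun2 and \<epsilon> :: int
  assumes \<epsilon>_pos: "\<epsilon> > 0"
    and independent: "laurent_independent (cluster_var b c m) (cluster_var b c (m + 1))"
    and right: "\<exists>\<alpha> \<beta>. \<alpha> \<ge> 0 \<and> \<beta> \<ge> 0 \<and> (odd m \<longrightarrow> \<epsilon> * \<beta> < \<alpha>) \<and>
      cluster_var b c (m + 1 + int n) \<in> nonneg_laurent (cluster_var b c m) (cluster_var b c (m + 1)) \<alpha> \<beta> 0 \<and>
      cluster_var b c (m + 2 + int n) \<in> nonneg_laurent (cluster_var b c m) (cluster_var b c (m + 1)) \<alpha> \<beta> (- 1)"
    and left: "\<exists>\<alpha> \<beta>. \<alpha> \<ge> 0 \<and> \<beta> \<ge> 0 \<and>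
      cluster_var b c (m - int n) \<in> nonneg_laurent (cluster_var b c m) (cluster_var b c (m + 1)) \<alpha> \<beta> 0 \<and>
      cluster_var b c (m - 1 - int n) \<in> nonneg_laurent (cluster_var b c m) (cluster_var b c (m + 1)) \<alpha> \<beta> (- 1)"
    and chebyshev: "\<exists>\<alpha> \<beta> i j. \<alpha> > 0 \<and> \<beta> > 0 \<and> \<alpha> * i + \<beta> * j = 0 \<and> (i, j) \<noteq> (0, 0) \<and>
      (odd m \<longrightarrow> i = 1 \<and> j = - \<epsilon>) \<and>
      (\<forall>n. \<exists>\<rho>\<in>nonneg_laurent (cluster_var b c m) (cluster_var b c (m + 1)) \<alpha> \<beta> (- 1).
        chebyshev_trace z n = cluster_var b c m powi (int n * i) * cluster_var b c (m + 1) powi (int n * j) +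
          cluster_var b c m powi (- int n * i) * cluster_var b c (m + 1) powi (- int n * j) + \<rho>)"
begin

abbreviation y :: "int \<Rightarrow> ratfun2" where
  "y \<equiv> cluster_var b c"

abbreviation candidate :: "ratfun2 set" where
  "candidate \<equiv> cluster_monomials b c \<union> {chebyshev_trace z n | n. n \<ge> 1}"

lemma negative_monomial:
  assumes "x \<in> nonneg_laurent (y m) (y (m + 1)) \<alpha> \<beta> 0"
    and "w \<in> nonneg_laurent (y m) (y (m + 1)) \<alpha> \<beta> (- 1)" "q > 0"
  shows "x ^ p * w ^ q \<in> nonneg_laurent (y m) (y (m + 1)) \<alpha> \<beta> (- 1)"
proof -
  have "x ^ p * w ^ q \<in> nonneg_laurent (y m) (y (m + 1)) \<alpha> \<beta> (int p * 0 + int q * - 1)"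
    by (intro nonneg_laurent_mult nonneg_laurent_power cluster_var_nonzero assms)
  then show ?thesis
    by (rule nonneg_laurent_mono) (use assms(3) in simp)
qed

text \<open>If \<open>q = 0\<close>, the power \<open>y M ^ p\<close> is regarded as a monomial in the preceding cluster, so that
  the farther of the two variables always has a positive exponent and makes the degree negative.\<close>

lemma monomial_right:
  assumes "m \<le> M" "x = y M ^ p * y (M + 1) ^ q"
  shows "(\<exists>p q. x = y m ^ p * y (m + 1) ^ q) \<or> (\<exists>\<alpha> \<beta>. \<alpha> \<ge> 0 \<and> \<beta> \<ge> 0 \<and> (odd m \<longrightarrow> \<epsilon> * \<beta> < \<alpha>) \<and>
    x \<in> nonneg_laurent (y m) (y (m + 1)) \<alpha> \<beta> (- 1))"
proof -
  have far: ?thesis if "k > m" "x = y k ^ p * y (k + 1) ^ q" "q > 0" for k p q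
  proof -
    have "k = m + 1 + int (nat (k - m - 1))" "k + 1 = m + 2 + int (nat (k - m - 1))"
      using that(1) by simp_all
    then show ?thesis
      using right[of m "nat (k - m - 1)"] negative_monomial[OF _ _ that(3), of "y k" m _ _ "y (k + 1)" p]
      unfolding that(2) by metis
  qed
  consider "M = m" | "M > m" "q > 0" | "q = 0" "M = m + 1" | "q = 0" "p = 0" | "q = 0" "p > 0" "M > m + 1"
    using assms(1) by linarith
  then show ?thesis
  proof cases
    case 3
    then have "x = y m ^ 0 * y (m + 1) ^ p"
      using assms(2) by simp
    then show ?thesis by blast
  next
    case 4
    then have "x = y m ^ 0 * y (m + 1) ^ 0"
      using assms(2) by simp
    then show ?thesis by blast
  next
    case 5
    then show ?thesis
      using far[of "M - 1" 0 p] assms(2) by simp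
  qed (use assms(2) far in blast)+
qed

lemma monomial_left:
  assumes "M < m" "x = y M ^ p * y (M + 1) ^ q"
  shows "(\<exists>p q. x = y m ^ p * y (m + 1) ^ q) \<or> (\<exists>\<alpha> \<beta>. \<alpha> \<ge> 0 \<and> \<beta> \<ge> 0 \<and>
    x \<in> nonneg_laurent (y m) (y (m + 1)) \<alpha> \<beta> (- 1))"
proof -
  have far: ?thesis if "k < m" "x = y (k + 1) ^ q * y k ^ p" "p > 0" for k p q
  proof -
    have "k + 1 = m - int (nat (m - k - 1))" "k = m - 1 - int (nat (m - k - 1))"
      using that(1) by simp_all
    then show ?thesis
      using left[of m "nat (m - k - 1)"] negative_monomial[OF _ _ that(3), of "y (k + 1)" m _ _ "y k" q]
      unfolding that(2) by metis
  qed
  consider "p > 0" | "p = 0" "M + 1 = m" | "p = 0" "q = 0" | "p = 0" "q > 0" "M + 1 < m"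
    using assms(1) by linarith
  then show ?thesis
  proof cases
    case 1
    then show ?thesis
      using far[of M q p] assms by (simp add: mult.commute)
  next
    case 2
    then have "x = y m ^ q * y (m + 1) ^ 0"
      using assms(2) by simp
    then show ?thesis by blast
  next
    case 3
    then have "x = y m ^ 0 * y (m + 1) ^ 0"
      using assms(2) by simp
    then show ?thesis by blast
  next
    case 4
    then show ?thesis
      using far[of "M + 1" 0 q] assms(2) by simp
  qed
qed

lemma cluster_monomial_cases:
  assumes "x \<in> cluster_monomials b c"
  obtains p q where "x = y m ^ p * y (m + 1) ^ q"
    | \<alpha> \<beta> where "\<alpha> \<ge> 0" "\<beta> \<ge> 0" "x \<in> nonneg_laurent (y m) (y (m + 1)) \<alpha> \<beta> (- 1)"
proof -
  obtain M p q where "x = y M ^ p * y (M + 1) ^ q"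
    using assms by (auto simp: cluster_monomials_def)
  then show thesis
    using monomial_right[of m M x p q] monomial_left[of M m x p q] that by (cases "m \<le> M") fastforce+
qed

lemma cluster_monomial_powi:
  "y m ^ p * y (m + 1) ^ q = y m powi int p * y (m + 1) powi int q"
  by simp

lemma candidate_nonneg:
  assumes "x \<in> candidate"
  shows "\<exists>\<alpha> \<beta> d. x \<in> nonneg_laurent (y m) (y (m + 1)) \<alpha> \<beta> d"
  using assms
proof
  assume "x \<in> cluster_monomials b c"
  then show ?thesis
  proof (cases rule: cluster_monomial_cases[where m = m])
    case (1 p q)
    have "x \<in> nonneg_laurent (y m) (y (m + 1)) 0 0 0"
      unfolding 1 cluster_monomial_powi by (rule nonneg_laurent_monomial) simp
    then show ?thesis by blast
  qed blast
next
  assume "x \<in> {chebyshev_trace z n | n. n \<ge> 1}"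
  then obtain n where n: "x = chebyshev_trace z n"
    by blast
  obtain \<alpha> \<beta> i j \<rho> where ij: "\<alpha> * i + \<beta> * j = 0" and
    \<rho>: "\<rho> \<in> nonneg_laurent (y m) (y (m + 1)) \<alpha> \<beta> (- 1)" and
    x: "x = y m powi (int n * i) * y (m + 1) powi (int n * j) +
      y m powi (- int n * i) * y (m + 1) powi (- int n * j) + \<rho>"
    using chebyshev[of m] unfolding n by blast
  have weight: "\<alpha> * (k * i) + \<beta> * (k * j) = 0" for k
    using ij by (metis distrib_left mult.left_commute mult_zero_right)
  have "x \<in> nonneg_laurent (y m) (y (m + 1)) \<alpha> \<beta> 0"
    unfolding x by (intro nonneg_laurent_add nonneg_laurent_monomial nonneg_laurent_mono[OF \<rho>])
      (simp_all only: weight order_refl)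
  then show ?thesis by blast
qed

text \<open>All exponents of \<open>z\<^sub>n\<close> have weight at most \<open>0\<close>. Both weights being positive, only the exponent
  \<open>(0, 0)\<close> of the quadrant could occur, but the leading exponents are nonzero.\<close>

lemma chebyshev_quadrant_coeff:
  assumes "n \<ge> 1"
  shows "has_coeff (y m) (y (m + 1)) (int p, int q) (chebyshev_trace z n) 0"
proof -
  obtain \<alpha> \<beta> i j \<rho> where ij: "\<alpha> > 0" "\<beta> > 0" "\<alpha> * i + \<beta> * j = 0" "(i, j) \<noteq> (0, 0)" and
    \<rho>: "\<rho> \<in> nonneg_laurent (y m) (y (m + 1)) \<alpha> \<beta> (- 1)" and
    x: "chebyshev_trace z n = y m powi (int n * i) * y (m + 1) powi (int n * j) +
      y m powi (- int n * i) * y (m + 1) powi (- int n * j) + \<rho>"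
    using chebyshev[of m] by blast
  have ne: "(int p, int q) \<noteq> (k * i, k * j)" if "k \<noteq> 0" for k
  proof
    assume eq: "(int p, int q) = (k * i, k * j)"
    have "\<alpha> * int p + \<beta> * int q = k * (\<alpha> * i + \<beta> * j)"
      using eq by (simp add: algebra_simps)
    then have "\<alpha> * int p + \<beta> * int q = 0"
      using ij(3) by simp
    moreover have "\<alpha> * int p \<ge> 0" "\<beta> * int q \<ge> 0"
      using ij by simp_all
    ultimately have "\<alpha> * int p = 0" "\<beta> * int q = 0"
      by linarith+
    then have "p = 0" "q = 0"
      using ij by simp_all
    then show False
      using eq that ij(4) by simp
  qed
  have "\<alpha> * int p + \<beta> * int q \<ge> 0"
    using ij by simp
  then have "has_coeff (y m) (y (m + 1)) (int p, int q) \<rho> 0"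
    by (intro has_coeff_nonneg_laurent[OF \<rho>]) simp
  then have "has_coeff (y m) (y (m + 1)) (int p, int q) (chebyshev_trace z n) (0 + 0 + 0)"
    unfolding x using ne[of "int n"] ne[of "- int n"] assms
      has_coeff_monomial[of "y m" "y (m + 1)" "(int p, int q)" "int n * i" "int n * j"]
      has_coeff_monomial[of "y m" "y (m + 1)" "(int p, int q)" "- int n * i" "- int n * j"]
    by (intro has_coeff_add) auto
  then show ?thesis
    by simp
qed

text \<open>A cluster monomial not taken from the cluster \<open>(y m, y (m + 1))\<close> has negative degree for some
  nonnegative weights, whereas monomials with two nonnegative exponents have nonnegative degree.\<close>

lemma quadrant_coeff:
  assumes "x \<in> candidate" "x \<noteq> y m ^ p * y (m + 1) ^ q"
  shows "has_coeff (y m) (y (m + 1)) (int p, int q) x 0"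
  using assms(1)
proof
  assume "x \<in> cluster_monomials b c"
  then show ?thesis
  proof (cases rule: cluster_monomial_cases[where m = m])
    case (1 p' q')
    then have "(int p, int q) \<noteq> (int p', int q')"
      using assms(2) by auto
    then show ?thesis
      unfolding 1 cluster_monomial_powi by (rule has_coeff_other_monomial)
  next
    case (2 \<alpha> \<beta>)
    then have "\<alpha> * int p + \<beta> * int q \<ge> 0"
      by simp
    then show ?thesis
      by (intro has_coeff_nonneg_laurent[OF 2(3)]) simp
  qed
qed (use chebyshev_quadrant_coeff in blast)

lemma monomial_coeff_self:
  "has_coeff (y m) (y (m + 1)) (int p, int q) (y m ^ p * y (m + 1) ^ q) 1"
  using has_coeff_monomial[of "y m" "y (m + 1)" "(int p, int q)" "int p" "int q"]
  unfolding cluster_monomial_powi by simp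

lemma monomial_not_chebyshev:
  assumes "n \<ge> 1"
  shows "chebyshev_trace z n \<notin> cluster_monomials b c"
proof
  assume "chebyshev_trace z n \<in> cluster_monomials b c"
  then obtain m p q where eq: "chebyshev_trace z n = y m ^ p * y (m + 1) ^ q"
    by (auto simp: cluster_monomials_def)
  show False
    using has_coeff_unique[OF independent chebyshev_quadrant_coeff[OF assms, of m p q]]
      monomial_coeff_self[of m p q] unfolding eq by fastforce
qed

lemma chebyshev_coeff:
  assumes "odd m" "l \<ge> 1" "n \<ge> 1"
  shows "has_coeff (y m) (y (m + 1)) (int n, - (int n * \<epsilon>)) (chebyshev_trace z l) (if l = n then 1 else 0)"
proof -
  let ?k = "(int n, - (int n * \<epsilon>))"
  obtain \<alpha> \<beta> i j \<rho> where ij: "\<alpha> * i + \<beta> * j = 0" "i = 1" "j = - \<epsilon>" and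
    \<rho>: "\<rho> \<in> nonneg_laurent (y m) (y (m + 1)) \<alpha> \<beta> (- 1)" and
    eq: "chebyshev_trace z l = y m powi (int l * i) * y (m + 1) powi (int l * j) +
      y m powi (- int l * i) * y (m + 1) powi (- int l * j) + \<rho>"
    using chebyshev[of m] assms(1) by blast
  have "\<alpha> * int n + \<beta> * - (int n * \<epsilon>) = int n * (\<alpha> * i + \<beta> * j)"
    using ij(2,3) by (simp add: algebra_simps)
  then have "\<alpha> * int n + \<beta> * - (int n * \<epsilon>) = 0"
    by (simp only: ij(1) mult_zero_right)
  then have "has_coeff (y m) (y (m + 1)) ?k \<rho> 0"
    by (intro has_coeff_nonneg_laurent[OF \<rho>]) (simp only: fst_conv snd_conv)
  moreover have "has_coeff (y m) (y (m + 1)) ?k (y m powi (int l * i) * y (m + 1) powi (int l * j))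
      (if l = n then 1 else 0)"
    using has_coeff_monomial[of "y m" "y (m + 1)" ?k "int l * i" "int l * j"]
    using ij(2,3) by (cases "l = n") simp_all
  moreover have "has_coeff (y m) (y (m + 1)) ?k (y m powi (- int l * i) * y (m + 1) powi (- int l * j)) 0"
    using has_coeff_monomial[of "y m" "y (m + 1)" ?k "- int l * i" "- int l * j"] assms ij(2,3) by simp
  ultimately have "has_coeff (y m) (y (m + 1)) ?k (chebyshev_trace z l) ((if l = n then 1 else 0) + 0 + 0)"
    unfolding eq by (intro has_coeff_add)
  then show ?thesis
    by simp
qed

lemma chebyshev_eq_iff:
  assumes "l \<ge> 1" "n \<ge> 1"
  shows "chebyshev_trace z l = chebyshev_trace z n \<longleftrightarrow> l = n"
proof
  assume eq: "chebyshev_trace z l = chebyshev_trace z n"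
  have "has_coeff (y 1) (y (1 + 1)) (int n, - (int n * \<epsilon>)) (chebyshev_trace z n) (if l = n then 1 else 0)"
    using chebyshev_coeff[of 1 l n] assms by (simp add: eq)
  moreover have "has_coeff (y 1) (y (1 + 1)) (int n, - (int n * \<epsilon>)) (chebyshev_trace z n) 1"
    using chebyshev_coeff[of 1 n n] assms by simp
  ultimately have "(if l = n then 1 else 0) = (1 :: int)"
    by (rule has_coeff_unique[OF independent])
  then show "l = n"
    by (simp split: if_splits)
qed simp

text \<open>In an odd cluster the exponent \<open>(n, - n * \<epsilon>)\<close> occurs in no other Chebyshev element, in no monomial of
  the cluster itself, and in no cluster monomial to the right. The argument says nothing about monomials to
  the left, so the cluster is chosen to the left of the finitely many monomials concerned.\<close>

lemma chebyshev_dual: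
  assumes "finite S" "S \<subseteq> candidate" "n \<ge> 1"
  shows "\<exists>m k. \<forall>x\<in>S. has_coeff (y m) (y (m + 1)) k x (if x = chebyshev_trace z n then 1 else 0)"
proof -
  have "\<forall>x\<in>S. \<exists>M. x \<in> cluster_monomials b c \<longrightarrow> (\<exists>p q. x = y M ^ p * y (M + 1) ^ q)"
    by (auto simp: cluster_monomials_def)
  then obtain M where M: "\<forall>x\<in>S. x \<in> cluster_monomials b c \<longrightarrow> (\<exists>p q. x = y (M x) ^ p * y (M x + 1) ^ q)"
    by (rule bchoice[THEN exE])
  \<comment> \<open>an odd index to the left of all clusters involved\<close>
  define m where "m = - 2 * (\<Sum>x\<in>S. \<bar>M x\<bar>) - 1"
  have "odd m"
    by (simp add: m_def)
  have m: "m \<le> M x" if "x \<in> S" for x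
  proof -
    have "\<bar>M x\<bar> \<le> (\<Sum>x\<in>S. \<bar>M x\<bar>)"
      using assms(1) that by (intro member_le_sum) auto
    then show ?thesis
      unfolding m_def by linarith
  qed
  let ?k = "(int n, - (int n * \<epsilon>))"
  have "has_coeff (y m) (y (m + 1)) ?k x (if x = chebyshev_trace z n then 1 else 0)" if x: "x \<in> S" for x
  proof (cases "x \<in> cluster_monomials b c")
    case True
    then have ne: "x \<noteq> chebyshev_trace z n"
      using monomial_not_chebyshev assms(3) by blast
    obtain p q where "x = y (M x) ^ p * y (M x + 1) ^ q"
      using M x True by blast
    then consider p q where "x = y m ^ p * y (m + 1) ^ q"
      | \<alpha> \<beta> where "\<epsilon> * \<beta> < \<alpha>" "x \<in> nonneg_laurent (y m) (y (m + 1)) \<alpha> \<beta> (- 1)"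
      using monomial_right[OF m[OF x]] \<open>odd m\<close> by metis
    then show ?thesis
    proof cases
      case (1 p q)
      have "int n * \<epsilon> > 0"
        using assms(3) \<epsilon>_pos by simp
      then have "?k \<noteq> (int p, int q)"
        by auto
      then show ?thesis
        using has_coeff_other_monomial[of ?k "int p" "int q" "y m" "y (m + 1)"] ne
        unfolding 1 cluster_monomial_powi by simp
    next
      case (2 \<alpha> \<beta>)
      have "\<alpha> * int n + \<beta> * - (int n * \<epsilon>) = int n * (\<alpha> - \<epsilon> * \<beta>)"
        by (simp add: algebra_simps)
      also have "\<dots> \<ge> 0"
        using 2(1) by simp
      finally show ?thesis
        using ne has_coeff_nonneg_laurent[OF 2(2), of ?k] by simp
    qed
  next
    case False
    then obtain l where l: "x = chebyshev_trace z l" "l \<ge> 1"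
      using assms(2) x by blast
    then show ?thesis
      using chebyshev_coeff[OF \<open>odd m\<close> l(2) assms(3)] chebyshev_eq_iff[OF l(2) assms(3)] by simp
  qed
  then show ?thesis
    by blast
qed

lemma is_canonical_basis_candidate:
  assumes span: "cluster_algebra b c \<subseteq> zmod.span candidate" and z: "z \<in> cluster_algebra b c"
  shows "is_canonical_basis b c candidate"
proof (rule is_canonical_basisI[OF independent span])
  fix x assume x: "x \<in> candidate"
  have "chebyshev_trace z n \<in> cluster_algebra b c" for n
  proof (induction n rule: induct_nat_012)
    case 0
    show ?case
      using cluster_algebra_of_int[of 2] by simp
  qed (use z in \<open>auto intro: cluster_algebra.diff cluster_algebra.mult\<close>)
  then have "x \<in> cluster_algebra b c"
    using x by (auto simp: cluster_monomials_def
      intro: cluster_algebra.mult cluster_algebra.var cluster_algebra_power)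
  moreover have "\<exists>f. laurent_eval f (y m) (y (m + 1)) = x \<and>
      (\<forall>k\<in>Poly_Mapping.keys f. Poly_Mapping.lookup f k > 0)" for m
  proof -
    obtain f where "laurent_eval f (y m) (y (m + 1)) = x" "\<forall>k. Poly_Mapping.lookup f k \<ge> 0"
      using candidate_nonneg[OF x, of m] nonneg_laurent_expansion by blast
    then show ?thesis
      by (intro exI[of _ f]) (simp add: in_keys_iff order_less_le del: split_paired_All)
  qed
  moreover have "x \<noteq> 0"
  proof
    assume "x = 0"
    have zero: "has_coeff (y m) (y (m + 1)) k 0 0" for m k
      unfolding has_coeff_def by (rule exI[of _ 0]) (simp add: laurent_eval_0)
    from x show False
    proof
      assume "x \<in> cluster_monomials b c"
      then show False
        using \<open>x = 0\<close> cluster_var_nonzero by (auto simp: cluster_monomials_def)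
    next
      assume "x \<in> {chebyshev_trace z n | n. n \<ge> 1}"
      then obtain n where "x = chebyshev_trace z n" "n \<ge> 1"
        by blast
      then have "has_coeff (y 1) (y (1 + 1)) (int n, - (int n * \<epsilon>)) 0 1"
        using chebyshev_coeff[of 1 n n] \<open>x = 0\<close> by simp
      from has_coeff_unique[OF independent zero this] show False
        by simp
    qed
  qed
  ultimately show "positive_element b c x"
    by (simp add: positive_element_def)
next
  fix S s assume S: "finite S" "S \<subseteq> candidate" "s \<in> S"
  then have "s \<in> candidate"
    by blast
  then show "\<exists>m k. \<forall>x\<in>S. has_coeff (y m) (y (m + 1)) k x (if x = s then 1 else 0)"
  proof
    assume "s \<in> cluster_monomials b c"
    then obtain m p q where s: "s = y m ^ p * y (m + 1) ^ q"
      by (auto simp: cluster_monomials_def)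
    have "\<forall>x\<in>S. has_coeff (y m) (y (m + 1)) (int p, int q) x (if x = s then 1 else 0)"
      using S(2) quadrant_coeff[of _ m p q] monomial_coeff_self[of m p q] unfolding s by auto
    then show ?thesis
      by blast
  next
    assume "s \<in> {chebyshev_trace z n | n. n \<ge> 1}"
    then obtain n where s: "s = chebyshev_trace z n" "n \<ge> 1"
      by blast
    show ?thesis
      unfolding s(1) by (rule chebyshev_dual[OF S(1,2) s(2)])
  qed
qed

end

section \<open>The two cases\<close>

text \<open>Independence spreads from \<open>(y 1, y 2)\<close> to all clusters, one exchange at a time.\<close>

lemma cluster_laurent_independent:
  assumes "b > 0" "c > 0"
  shows "laurent_independent (cluster_var b c m) (cluster_var b c (m + 1))"
proof -
  let ?y = "cluster_var b c"
  have ex: "?y (m - 1) * ?y (m + 1) = ?y m ^ (if odd m then b else c) + 1" for m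
    by (rule cluster_var_exchange)
  have "alg_independent (?y m) (?y (m + 1))"
  proof (induction m rule: int_induct[of _ 1])
    case base
    show ?case
      by (simp add: cluster_var_1 cluster_var_2 alg_independent_vars)
  next
    case (step1 m)
    have "?y m * ?y (m + 1 + 1) = ?y (m + 1) ^ (if odd (m + 1) then b else c) + 1"
      using ex[of "m + 1"] by simp
    then have "alg_independent (?y (m + 1 + 1)) (?y (m + 1))"
      by (rule alg_independent_exchange[OF step1.IH]) (use assms in simp)
    then show ?case
      by (rule alg_independent_swap)
  next
    case (step2 m)
    have "?y (m + 1) * ?y (m - 1) = ?y m ^ (if odd m then b else c) + 1"
      using ex[of m] by (simp add: mult.commute)
    then have "alg_independent (?y (m - 1)) (?y m)"
      by (rule alg_independent_exchange[OF alg_independent_swap[OF step2.IH]]) (use assms in simp)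
    then show ?case
      by simp
  qed
  then show ?thesis
    by (rule laurent_independentI) (rule cluster_var_nonzero)+
qed

lemma z_seq_eq_chebyshev_trace:
  assumes "n \<ge> 1"
  shows "z_seq b c n = chebyshev_trace (z_elem b c) n"
proof -
  have T1: "chebyshev_T 1 = [:0, 1:]"
  proof (rule chebyshev_T_unique)
    fix t :: rat assume "t \<noteq> 0"
    then show "poly (map_poly of_int (chebyshev_T 1)) (t + inverse t) =
        poly (map_poly of_int [:0, 1:]) (t + inverse t)"
      by (simp add: poly_chebyshev_T map_poly_pCons)
  qed
  have T2: "chebyshev_T 2 = [:0, 1:] * chebyshev_T 1 - [:2:]"
  proof (rule chebyshev_T_unique)
    fix t :: rat assume t: "t \<noteq> 0"
    have "(t + inverse t) * (t + inverse t) - 2 = t ^ 2 + inverse t ^ 2"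
      using t by (simp add: power2_eq_square algebra_simps)
    then show "poly (map_poly of_int (chebyshev_T 2)) (t + inverse t) =
        poly (map_poly of_int ([:0, 1:] * chebyshev_T 1 - [:2:])) (t + inverse t)"
      using t by (simp add: poly_chebyshev_T T1 map_poly_pCons)
  qed
  have hom: "map_poly of_int ([:0, 1:] * p - q) = [:0, 1:] * map_poly of_int p - (map_poly of_int q :: 'a :: comm_ring_1 poly)"
    for p q :: "int poly"
    by (intro poly_eqI) (simp add: coeff_map_poly coeff_pCons split: nat.split)
  have T_rec: "chebyshev_T (Suc (Suc n)) = [:0, 1:] * chebyshev_T (Suc n) - chebyshev_T n" if "n \<ge> 1" for n
  proof (rule chebyshev_T_unique)
    fix t :: rat assume t: "t \<noteq> 0"
    have cancel: "t * (inverse t * x) = x" "inverse t * (t * x) = x" for x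
      using t by (simp_all flip: mult.assoc)
    have "(t + inverse t) * (t ^ Suc n + inverse t ^ Suc n) - (t ^ n + inverse t ^ n) =
        t ^ Suc (Suc n) + inverse t ^ Suc (Suc n)"
      by (simp add: distrib_right distrib_left cancel)
    then show "poly (map_poly of_int (chebyshev_T (Suc (Suc n)))) (t + inverse t) =
        poly (map_poly of_int ([:0, 1:] * chebyshev_T (Suc n) - chebyshev_T n)) (t + inverse t)"
      using t that by (simp only: hom poly_diff poly_mult) (simp add: poly_chebyshev_T)
  qed
  have "z_seq b c (Suc n) = chebyshev_trace (z_elem b c) (Suc n)" for n
  proof (induction n rule: induct_nat_012)
    case 0
    show ?case
      using T1 by (simp add: z_seq_def map_poly_pCons)
  next
    case 1
    show ?case
      using T1 T2 by (simp add: z_seq_def map_poly_pCons numeral_2_eq_2 algebra_simps)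
  next
    case (ge2 n)
    then show ?case
      using T_rec[of "Suc n"] by (simp only: z_seq_def hom poly_diff poly_mult) simp
  qed
  then show ?thesis
    using assms by (cases n) simp_all
qed

lemma exchange_22_cluster_var: "exchange_22 (cluster_var 2 2)"
  unfolding exchange_22_def using cluster_var_exchange[of 2 2] cluster_var_nonzero by simp

lemma exchange_14_cluster_var: "exchange_14 (cluster_var 1 4)"
  unfolding exchange_14_def using cluster_var_exchange[of 1 4] cluster_var_nonzero by simp

lemma z_elem_22: "z_elem 2 2 = z_22 (cluster_var 2 2)"
proof -
  let ?y = "cluster_var 2 2"
  have nz: "?y 1 \<noteq> 0" "?y 2 \<noteq> 0"
    by (rule cluster_var_nonzero)+
  have ex: "?y 0 * ?y 2 = (?y 1)\<^sup>2 + 1" "?y 1 * ?y 3 = (?y 2)\<^sup>2 + 1"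
    using exchange_22_cluster_var[unfolded exchange_22_def, rule_format, of 1]
      exchange_22_cluster_var[unfolded exchange_22_def, rule_format, of 2] by simp_all
  have "(?y 0 * ?y 3 - ?y 1 * ?y 2) * (?y 1 * ?y 2) =
      (?y 0 * ?y 2) * (?y 1 * ?y 3) - (?y 1 * ?y 2) * (?y 1 * ?y 2)"
    by (simp add: algebra_simps)
  also have "\<dots> = (?y 1)\<^sup>2 + (?y 2)\<^sup>2 + 1"
    unfolding ex by (simp add: algebra_simps power2_eq_square)
  finally have "?y 0 * ?y 3 - ?y 1 * ?y 2 = z_22 ?y"
    using nz by (simp add: z_22_def eq_divide_eq)
  then show ?thesis
    by (simp add: z_elem_def)
qed

lemma z_elem_14: "z_elem 1 4 = z_14 (cluster_var 1 4)"
proof -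
  let ?y = "cluster_var 1 4"
  have nz: "?y 1 \<noteq> 0" "?y 2 \<noteq> 0"
    by (rule cluster_var_nonzero)+
  have ex: "?y 0 * ?y 2 = ?y 1 + 1" "?y 1 * ?y 3 = ?y 2 ^ 4 + 1"
    using exchange_14_cluster_var[unfolded exchange_14_def, rule_format, of 1]
      exchange_14_cluster_var[unfolded exchange_14_def, rule_format, of 2] by simp_all
  have "((?y 0)\<^sup>2 * ?y 3 - (?y 1 + 2) * (?y 2)\<^sup>2) * (?y 1 * (?y 2)\<^sup>2) =
      (?y 0 * ?y 2)\<^sup>2 * (?y 1 * ?y 3) - (?y 1 + 2) * (?y 2)\<^sup>2 * (?y 1 * (?y 2)\<^sup>2)"
    by (simp add: algebra_simps power2_eq_square)
  also have "\<dots> = ?y 2 ^ 4 + (?y 1 + 1)\<^sup>2"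
    unfolding ex by (simp add: algebra_simps power2_eq_square power4_eq_xxxx)
  finally have "(?y 0)\<^sup>2 * ?y 3 - (?y 1 + 2) * (?y 2)\<^sup>2 = z_14 ?y"
    using nz by (simp add: z_14_def eq_divide_eq)
  then show ?thesis
    by (simp add: z_elem_def)
qed

lemma affine_pattern_22: "affine_pattern 2 2 (z_elem 2 2) 1"
proof
  let ?y = "cluster_var 2 2"
  note Y = exchange_22_cluster_var
  show "laurent_independent (?y m) (?y (m + 1))" for m
    by (rule cluster_laurent_independent) simp_all
  fix m
  note Y_right = exchange_22_shift[OF Y, of "m - 1"] and Y_left = exchange_22_reflect[OF Y, of "m + 2"]
  show "\<exists>\<alpha> \<beta>. \<alpha> \<ge> 0 \<and> \<beta> \<ge> 0 \<and> (odd m \<longrightarrow> 1 * \<beta> < \<alpha>) \<and>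
      ?y (m + 1 + int n) \<in> nonneg_laurent (?y m) (?y (m + 1)) \<alpha> \<beta> 0 \<and>
      ?y (m + 2 + int n) \<in> nonneg_laurent (?y m) (?y (m + 1)) \<alpha> \<beta> (- 1)" for n
    using exchange_22_degree[OF Y_right, of n]
    by (intro exI[of _ "int n + 1"] exI[of _ "int n"]) (simp add: algebra_simps)
  show "\<exists>\<alpha> \<beta>. \<alpha> \<ge> 0 \<and> \<beta> \<ge> 0 \<and>
      ?y (m - int n) \<in> nonneg_laurent (?y m) (?y (m + 1)) \<alpha> \<beta> 0 \<and>
      ?y (m - 1 - int n) \<in> nonneg_laurent (?y m) (?y (m + 1)) \<alpha> \<beta> (- 1)" for n
    using exchange_22_degree[OF Y_left, of n, THEN nonneg_laurent_swap]
    by (intro exI[of _ "int n"] exI[of _ "int n + 1"]) (simp add: algebra_simps)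
  have "\<exists>\<rho>\<in>nonneg_laurent (?y m) (?y (m + 1)) 1 1 (- 1).
      chebyshev_trace (z_elem 2 2) n = ?y m powi (int n * 1) * ?y (m + 1) powi (int n * - 1) +
        ?y m powi (- int n * 1) * ?y (m + 1) powi (- int n * - 1) + \<rho>" for n
    using exchange_22_chebyshev[OF Y_right, of n, unfolded z_22_shift[OF Y]]
    by (simp add: z_elem_22 algebra_simps)
  then show "\<exists>\<alpha> \<beta> i j. \<alpha> > 0 \<and> \<beta> > 0 \<and> \<alpha> * i + \<beta> * j = 0 \<and> (i, j) \<noteq> (0, 0) \<and>
      (odd m \<longrightarrow> i = 1 \<and> j = - 1) \<and> (\<forall>n. \<exists>\<rho>\<in>nonneg_laurent (?y m) (?y (m + 1)) \<alpha> \<beta> (- 1).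
        chebyshev_trace (z_elem 2 2) n = ?y m powi (int n * i) * ?y (m + 1) powi (int n * j) +
          ?y m powi (- int n * i) * ?y (m + 1) powi (- int n * j) + \<rho>)"
    by (intro exI[of _ 1] exI[of _ "- 1"]) simp
qed simp

text \<open>For odd \<open>m\<close> the pattern is shifted so that \<open>(y m, y (m + 1))\<close> becomes the pair with indices
  \<open>1\<close> and \<open>2\<close>; for even \<open>m\<close> it is reflected, which exchanges the directions right and left as well as
  the two members of the cluster.\<close>

lemma affine_pattern_14: "affine_pattern 1 4 (z_elem 1 4) 2"
proof
  let ?y = "cluster_var 1 4"
  note Y = exchange_14_cluster_var
  show "laurent_independent (?y m) (?y (m + 1))" for m
    by (rule cluster_laurent_independent) simp_all
  fix m
  have Y_odd: "exchange_14 (\<lambda>k. ?y (m - 1 + k))" "z_14 (\<lambda>k. ?y (m - 1 + k)) = z_elem 1 4" if "odd m"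
  proof -
    have "2 * ((m - 1) div 2) = m - 1"
      using that by simp
    then show "exchange_14 (\<lambda>k. ?y (m - 1 + k))" "z_14 (\<lambda>k. ?y (m - 1 + k)) = z_elem 1 4"
      using exchange_14_shift[OF Y, of "(m - 1) div 2"] z_14_shift[OF Y, of "(m - 1) div 2"]
      by (simp_all only: z_elem_14)
  qed
  have Y_even: "exchange_14 (\<lambda>k. ?y (m + 2 - k))" "z_14 (\<lambda>k. ?y (m + 2 - k)) = z_elem 1 4" if "even m"
  proof -
    have "2 * ((m + 2) div 2) = m + 2"
      using that by simp
    then show "exchange_14 (\<lambda>k. ?y (m + 2 - k))" "z_14 (\<lambda>k. ?y (m + 2 - k)) = z_elem 1 4"
      using exchange_14_reflect[OF Y, of "(m + 2) div 2"] z_14_reflect[OF Y, of "(m + 2) div 2"]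
      by (simp_all only: z_elem_14)
  qed
  show "\<exists>\<alpha> \<beta>. \<alpha> \<ge> 0 \<and> \<beta> \<ge> 0 \<and> (odd m \<longrightarrow> 2 * \<beta> < \<alpha>) \<and>
      ?y (m + 1 + int n) \<in> nonneg_laurent (?y m) (?y (m + 1)) \<alpha> \<beta> 0 \<and>
      ?y (m + 2 + int n) \<in> nonneg_laurent (?y m) (?y (m + 1)) \<alpha> \<beta> (- 1)" for n
  proof (cases "odd m")
    case True
    then show ?thesis
      using exchange_14_degree_right[OF Y_odd(1), of n]
      by (intro exI[of _ "2 * int n + 2"] exI[of _ "int n"]) (simp add: algebra_simps)
  next
    case False
    then show ?thesis
      using exchange_14_degree_left[OF Y_even(1), of n, THEN nonneg_laurent_swap]
      by (intro exI[of _ "int n + 1"] exI[of _ "2 * int n"]) (simp add: algebra_simps)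
  qed
  show "\<exists>\<alpha> \<beta>. \<alpha> \<ge> 0 \<and> \<beta> \<ge> 0 \<and>
      ?y (m - int n) \<in> nonneg_laurent (?y m) (?y (m + 1)) \<alpha> \<beta> 0 \<and>
      ?y (m - 1 - int n) \<in> nonneg_laurent (?y m) (?y (m + 1)) \<alpha> \<beta> (- 1)" for n
  proof (cases "odd m")
    case True
    then show ?thesis
      using exchange_14_degree_left[OF Y_odd(1), of n]
      by (intro exI[of _ "2 * int n"] exI[of _ "int n + 1"]) (simp add: algebra_simps)
  next
    case False
    then show ?thesis
      using exchange_14_degree_right[OF Y_even(1), of n, THEN nonneg_laurent_swap]
      by (intro exI[of _ "int n"] exI[of _ "2 * int n + 2"]) (simp add: algebra_simps)
  qed
  show "\<exists>\<alpha> \<beta> i j. \<alpha> > 0 \<and> \<beta> > 0 \<and> \<alpha> * i + \<beta> * j = 0 \<and> (i, j) \<noteq> (0, 0) \<and>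
      (odd m \<longrightarrow> i = 1 \<and> j = - 2) \<and> (\<forall>n. \<exists>\<rho>\<in>nonneg_laurent (?y m) (?y (m + 1)) \<alpha> \<beta> (- 1).
        chebyshev_trace (z_elem 1 4) n = ?y m powi (int n * i) * ?y (m + 1) powi (int n * j) +
          ?y m powi (- int n * i) * ?y (m + 1) powi (- int n * j) + \<rho>)"
  proof (cases "odd m")
    case True
    have "\<exists>\<rho>\<in>nonneg_laurent (?y m) (?y (m + 1)) 2 1 (- 1).
        chebyshev_trace (z_elem 1 4) n = ?y m powi (int n * 1) * ?y (m + 1) powi (int n * - 2) +
          ?y m powi (- int n * 1) * ?y (m + 1) powi (- int n * - 2) + \<rho>" for n
      using exchange_14_chebyshev[OF Y_odd(1)[OF True], of n, unfolded Y_odd(2)[OF True]]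
      by (simp add: algebra_simps)
    then show ?thesis
      by (intro exI[of _ 2] exI[of _ 1] exI[of _ 1] exI[of _ "- 2"]) simp
  next
    case False
    have "\<exists>\<rho>\<in>nonneg_laurent (?y m) (?y (m + 1)) 1 2 (- 1).
        chebyshev_trace (z_elem 1 4) n = ?y m powi (int n * - 2) * ?y (m + 1) powi (int n * 1) +
          ?y m powi (- int n * - 2) * ?y (m + 1) powi (- int n * 1) + \<rho>" for n
    proof -
      have "even m"
        using False by simp
      from exchange_14_chebyshev[OF Y_even(1)[OF this], of n] obtain \<rho> where \<rho>:
        "\<rho> \<in> nonneg_laurent (?y (m + 2 - 1)) (?y (m + 2 - 2)) 2 1 (- 1)"
        "chebyshev_trace (z_elem 1 4) n = ?y (m + 2 - 1) powi int n * ?y (m + 2 - 2) powi (- 2 * int n) +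
          ?y (m + 2 - 1) powi (- int n) * ?y (m + 2 - 2) powi (2 * int n) + \<rho>"
        unfolding Y_even(2)[OF \<open>even m\<close>] by blast
      show ?thesis
        using nonneg_laurent_swap[OF \<rho>(1)] \<rho>(2)
        by (intro bexI[of _ \<rho>]) (simp_all add: add.commute mult_ac)
    qed
    then show ?thesis
      using False by (intro exI[of _ 1] exI[of _ 2] exI[of _ "- 2"] exI[of _ 1]) simp
  qed
qed simp

lemma powers_in_span_candidate:
  "z ^ n \<in> zmod.span (cluster_monomials b c \<union> {chebyshev_trace z n | n. n \<ge> 1})"
proof -
  have "1 = cluster_var b c 1 ^ 0 * cluster_var b c (1 + 1) ^ 0"
    by simp
  then have "1 \<in> cluster_monomials b c"
    unfolding cluster_monomials_def by blast
  then have "insert 1 {chebyshev_trace z n | n. n \<ge> 1} \<subseteq>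
      cluster_monomials b c \<union> {chebyshev_trace z n | n. n \<ge> 1}"
    by blast
  then show ?thesis
    using powers_in_span_chebyshev[of z n] zmod.span_mono by blast
qed

text \<open>Straightening applies with \<open>\<delta> = 1\<close>, by the exchange relation itself.\<close>

lemma cluster_algebra_22_spanned:
  "cluster_algebra 2 2 \<subseteq> zmod.span (cluster_monomials 2 2 \<union> {chebyshev_trace (z_elem 2 2) n | n. n \<ge> 1})"
  (is "_ \<subseteq> ?V")
proof (rule cluster_algebra_subset_span)
  let ?y = "cluster_var 2 2"
  show "?y m \<in> zmod.span (range (product_at ?y))" for m
    by (rule zmod.span_base) (auto intro: range_eqI[of _ _ "{#m#}"])
  have "z_elem 2 2 ^ 0 * product_at ?y M \<in> ?V" for M
  proof (rule straightening)
    show "?y (k - 1) + ?y (k + 1) = z_elem 2 2 * ?y k" for k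
      using exchange_22_linear[OF exchange_22_cluster_var, of "k - 1"] by (simp add: z_elem_22 add.commute)
    show "?y (k - 1) * ?y (k + 1) = (?y k)\<^sup>2 + 1" for k
      using exchange_22_cluster_var by (simp add: exchange_22_def)
    show "?y k ^ p * ?y (k + 1) ^ q \<in> ?V" for k p q
      by (rule zmod.span_base) (auto simp: cluster_monomials_def)
  qed (rule zmod.subspace_span powers_in_span_candidate | simp)+
  then show "product_at ?y M \<in> ?V" for M
    by simp
qed (rule zmod.subspace_span)

text \<open>With parameters \<open>(1, 4)\<close> the relation \<open>y (2 * k + 1) = y (2 * k) * y (2 * k + 2) - 1\<close> makes the
  variables with even index generate the algebra, and expanding \<open>(y (2 * k + 1) + 1) ^ p\<close> turns
  monomials in two consecutive ones into combinations of cluster monomials. Eliminating the odd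
  variables from the two expressions for \<open>z\<close> gives the relation of straightening with \<open>\<delta> = z\<close>.\<close>

lemma cluster_algebra_14_spanned:
  "cluster_algebra 1 4 \<subseteq> zmod.span (cluster_monomials 1 4 \<union> {chebyshev_trace (z_elem 1 4) n | n. n \<ge> 1})"
  (is "_ \<subseteq> ?V")
proof (rule cluster_algebra_subset_span)
  let ?y = "cluster_var 1 4"
  let ?z = "z_elem 1 4"
  define e where "e k = ?y (2 * k)" for k
  note Y = exchange_14_cluster_var
  have odd_eq: "e k * e (k + 1) = ?y (2 * k + 1) + 1" for k
    using exchange_14_product[OF Y, of k] by (simp add: e_def algebra_simps)
  show "?y m \<in> zmod.span (range (product_at e))" for m
  proof (cases "even m")
    case True
    then obtain k where "m = 2 * k" by blast
    then have "?y m = product_at e {#k#}"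
      by (simp add: e_def)
    then show ?thesis
      by (intro zmod.span_base) blast
  next
    case False
    then obtain k where "m = 2 * k + 1" by (rule oddE)
    then have "?y m = product_at e {#k, k + 1#} - product_at e {#}"
      using odd_eq[of k] by simp
    then show ?thesis
      by (simp only:) (intro zmod.span_diff zmod.span_base rangeI)
  qed
  have lin: "e (k - 1) + e (k + 1) = ?z * e k" for k
    using exchange_14_linear[OF Y, of "k - 1"] unfolding z_elem_14 by (simp add: e_def algebra_simps)
  have ex: "e (k - 1) * e (k + 1) = (e k)\<^sup>2 + ?z" for k
  proof -
    have w: "?y (2 * k + 1) * ?z = (e k)\<^sup>2 + (e (k + 1))\<^sup>2"
    proof -
      have "?z = ((e k)\<^sup>2 + (e (k + 1))\<^sup>2) / ?y (2 * k + 1)"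
        using z_14_eq(2)[OF exchange_14_shift[OF Y, of k], unfolded z_14_shift[OF Y]]
        unfolding z_elem_14 by (simp add: e_def distrib_left)
      then show ?thesis
        using cluster_var_nonzero by simp
    qed
    have "e (k - 1) * e (k + 1) = ?z * (e k * e (k + 1)) - (e (k + 1))\<^sup>2"
      using lin[of k] by (simp add: power2_eq_square eq_diff_eq mult.assoc flip: distrib_right)
    also have "\<dots> = ?y (2 * k + 1) * ?z + ?z - (e (k + 1))\<^sup>2"
      unfolding odd_eq by (simp add: algebra_simps)
    finally show ?thesis
      unfolding w by simp
  qed
  have adjacent: "e k ^ p * e (k + 1) ^ q \<in> ?V" for k p q
  proof -
    have mon: "?y m ^ i * ?y (m + 1) ^ j \<in> ?V" for m i j
      by (rule zmod.span_base) (auto simp: cluster_monomials_def)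
    have e_succ: "e (k + 1) = ?y (2 * k + 1 + 1)"
      by (simp add: e_def add.commute)
    show ?thesis
    proof (cases "p \<le> q")
      case True
      then have "e k ^ p * e (k + 1) ^ q = (e k * e (k + 1)) ^ p * e (k + 1) ^ (q - p)"
        by (simp add: power_mult_distrib mult.assoc flip: power_add)
      also have "\<dots> = (\<Sum>i\<le>p. of_int (int (p choose i)) * (?y (2 * k + 1) ^ i * ?y (2 * k + 1 + 1) ^ (q - p)))"
        unfolding odd_eq unfolding e_succ by (simp add: binomial_ring sum_distrib_left mult_ac)
      also have "\<dots> \<in> ?V"
        by (intro zmod.span_sum zmod.span_scale mon)
      finally show ?thesis .
    next
      case False
      then have "e k ^ p * e (k + 1) ^ q = e k ^ (p - q) * (e k * e (k + 1)) ^ q"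
        by (simp add: power_mult_distrib flip: power_add mult.assoc)
      also have "\<dots> = (\<Sum>i\<le>q. of_int (int (q choose i)) * (?y (2 * k) ^ (p - q) * ?y (2 * k + 1) ^ i))"
        unfolding odd_eq by (simp add: binomial_ring sum_distrib_left e_def mult_ac)
      also have "\<dots> \<in> ?V"
        by (intro zmod.span_sum zmod.span_scale mon)
      finally show ?thesis .
    qed
  qed
  have "?z ^ 0 * product_at e M \<in> ?V" for M
    by (rule straightening[OF lin ex _ zmod.subspace_span powers_in_span_candidate adjacent]) simp
  then show "product_at e M \<in> ?V" for M
    by simp
qed (rule zmod.subspace_span)

lemma z_elem_in_cluster_algebra:
  assumes "(b, c) = (2, 2) \<or> (b, c) = (1, 4)"
  shows "z_elem b c \<in> cluster_algebra b c"
proof -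
  have "2 \<in> cluster_algebra b c"
    using cluster_algebra_of_int[of 2] by simp
  then show ?thesis
    using assms by (auto simp: z_elem_def Let_def power2_eq_square
      intro!: cluster_algebra.diff cluster_algebra.mult cluster_algebra.var cluster_algebra_add)
qed

theorem theorem2p8:
  fixes b c :: nat
  assumes "(b, c) = (2, 2) \<or> (b, c) = (1, 4)"
  shows "canonical_basis b c = cluster_monomials b c \<union> {z_seq b c n | n. n \<ge> 1} \<and>
         cluster_monomials b c \<inter> {z_seq b c n | n. n \<ge> 1} = {}"
proof -
  have "affine_pattern b c (z_elem b c) (if b = 2 then 1 else 2)"
    using assms affine_pattern_22 affine_pattern_14 by auto
  then interpret affine_pattern b c "z_elem b c" "if b = 2 then 1 else 2" .
  have "cluster_algebra b c \<subseteq> zmod.span candidate"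
    using assms cluster_algebra_22_spanned cluster_algebra_14_spanned by auto
  then have "canonical_basis b c = candidate"
    by (intro canonical_basis_eqI is_canonical_basis_candidate z_elem_in_cluster_algebra assms)
  moreover have "{z_seq b c n | n. n \<ge> 1} = {chebyshev_trace (z_elem b c) n | n. n \<ge> 1}"
    by (intro Collect_cong ex_cong1) (auto simp: z_seq_eq_chebyshev_trace)
  ultimately show ?thesis
    using monomial_not_chebyshev by auto
qed

end
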